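(* Let $k\ge1$ be an integer. (i) For every triangle $f\subset\mathbb{R}^2$, the following degrees of freedom are unisolvent on $\mathrm{P}_k(f)\otimes\mathbb{S}_2$: for $\sigma\in \mathrm{P}_k(f)\otimes\mathbb{S}_2$, - $\sigma(x)$ at each vertex $x$ of $f$; - $\int_e(\tau^T\sigma\tau)\,p$ and $\int_e(\nu^T\sigma\nu)\,p$ for $p\in\mathrm{P}_{k-2}(e)$, for each edge $e$ of $f$ with unit tangent $\tau$ and unit normal $\nu$; - $\int_f\sigma:b$ for $b\in\hat{B}(f)$. (ii) For a triangulation $\mathcal{T}$ of a planar polygonal domain $\overline{\Omega}$, with sets $\mathcal{V},\mathcal{E},\mathcal{F}$ of vertices, edges and triangles, the resulting finite element space $\Sigma_k$ has dimension $$3|\mathcal{V}|+2(k-1)|\mathcal{E}|+\tfrac32(k-1)k\,|\mathcal{F}|.$$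
   Context: $\mathrm{P}_m(s)$: polynomials of degree at most $m$ on a simplex $s$ (zero space if $m<0$). $\mathbb{S}_2$: real symmetric $2\times2$ matrices; $A:B=\sum_{ij}A_{ij}B_{ij}$. $\hat{B}(f)$ is the space of $\sigma\in\mathrm{P}_k(f)\otimes\mathbb{S}_2$ such that $\tau^T\sigma\tau=0$ and $\nu^T\sigma\nu=0$ on each edge of $f$ (with $\tau,\nu$ the unit tangent and normal of that edge) and $\sigma(x)=0$ at each vertex $x$ of $f$. Unisolvent means: the linear forms listed (with $p$, $b$ ranging over bases of the indicated spaces) form a basis of the dual of $\mathrm{P}_k(f)\otimes\mathbb{S}_2$. $\Sigma_k$ is the space of piecewise fields $\sigma$ with $\sigma|_f\in\mathrm{P}_k(f)\otimes\mathbb{S}_2$ for each $f\in\mathcal{F}$, whose vertex and edge degrees of freedom are single-valued, i.e. agree when computed from the different triangles sharing that vertex or edge. *)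

theory Defs
  imports "HOL-Analysis.Analysis" "HOL-Library.Function_Algebras"
begin

instantiation "fun" :: (type, real_vector) real_vector
begin

definition scaleR_fun :: "real \<Rightarrow> ('a \<Rightarrow> 'b) \<Rightarrow> 'a \<Rightarrow> 'b" where
  "scaleR_fun c f = (\<lambda>x. c *\<^sub>R f x)"

instance
  by standard (simp_all add: scaleR_fun_def plus_fun_def fun_eq_iff scaleR_add_left scaleR_add_right)

end

type_synonym plane = "real^2"
type_synonym mat2 = "real^2^2"
type_synonym tensor_field = "plane \<Rightarrow> mat2"

text \<open>Functions on a set \<open>s\<close> are represented by their extensions by zero outside \<open>s\<close>, so that
  equality of representatives is equality on \<open>s\<close>. For an edge \<open>e\<close>, \<open>poly_space m e\<close> consists of
  the restrictions to \<open>e\<close> of bivariate polynomials, which are the polynomials of degree at most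
  \<open>m\<close> in an affine parameter of \<open>e\<close>.  The degree bound is an integer: for \<open>m < 0\<close> the space is
  \<open>{0}\<close>.\<close>

definition poly_space :: "int \<Rightarrow> plane set \<Rightarrow> (plane \<Rightarrow> real) set" where
  "poly_space m s =
     span {(\<lambda>x. if x \<in> s then (x $ 1) ^ i * (x $ 2) ^ j else 0) | i j :: nat. int (i + j) \<le> m}"

definition sym_mats :: "mat2 set" where
  "sym_mats = {A. transpose A = A}"

definition frob :: "mat2 \<Rightarrow> mat2 \<Rightarrow> real" where
  "frob A B = (\<Sum>i\<in>UNIV. \<Sum>j\<in>UNIV. A $ i $ j * B $ i $ j)"

definition sym_poly_space :: "nat \<Rightarrow> plane set \<Rightarrow> tensor_field set" where
  "sym_poly_space k f =
     {\<sigma>. (\<forall>x. \<sigma> x \<in> sym_mats) \<and> (\<forall>i j. (\<lambda>x. \<sigma> x $ i $ j) \<in> poly_space (int k) f)}"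

definition verts_of :: "plane set \<Rightarrow> plane set" where
  "verts_of f = {x. x extreme_point_of f}"

definition edges_of :: "plane set \<Rightarrow> plane set set" where
  "edges_of f = {e. e edge_of f}"

definition unit_tangent :: "plane set \<Rightarrow> plane \<Rightarrow> bool" where
  "unit_tangent e t \<longleftrightarrow> norm t = 1 \<and> (\<exists>x\<in>e. \<exists>y\<in>e. \<exists>c. t = c *\<^sub>R (y - x))"

definition unit_normal :: "plane set \<Rightarrow> plane \<Rightarrow> bool" where
  "unit_normal e n \<longleftrightarrow> norm n = 1 \<and> (\<forall>x\<in>e. \<forall>y\<in>e. n \<bullet> (y - x) = 0)"

text \<open>Integration over a segment with respect to arc length.\<close>

definition edge_integral :: "plane set \<Rightarrow> (plane \<Rightarrow> real) \<Rightarrow> real" where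
  "edge_integral e g =
     (THE I. \<exists>a b. e = closed_segment a b \<and>
        I = dist a b * integral {0..1} (\<lambda>t. g (linepath a b t)))"

lemma edge_integral_closed_segment:
  "edge_integral (closed_segment a b) g = dist a b * integral {0..1} (\<lambda>t. g (linepath a b t))"
proof -
  have rev: "integral {0..1} (\<lambda>t. g (linepath b a t)) = integral {0..1} (\<lambda>t. g (linepath a b t))"
    for a b :: plane
  proof -
    have "integral {0..1} (\<lambda>t. g (linepath a b t)) =
          integral {-1..0} (\<lambda>t. g (linepath a b (- t)))"
      using Henstock_Kurzweil_Integration.integral_reflect_real[of 1 0 "\<lambda>t. g (linepath a b t)"]
      by simp
    also have "\<dots> = integral {0..1} ((\<lambda>t. g (linepath a b (- t))) \<circ> (\<lambda>t. t + (-1)))"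
      using integral_shift_Icc_real[of 0 1 "\<lambda>t. g (linepath a b (- t))" "-1"]
      by (simp add: o_def)
    also have "\<dots> = integral {0..1} (\<lambda>t. g (linepath b a t))"
      by (simp add: o_def linepath_def algebra_simps)
    finally show ?thesis by simp
  qed
  show ?thesis
    unfolding edge_integral_def
  proof (rule the_equality)
    fix I assume "\<exists>c d. closed_segment a b = closed_segment c d \<and>
        I = dist c d * integral {0..1} (\<lambda>t. g (linepath c d t))"
    then obtain c d where "closed_segment a b = closed_segment c d"
      and I: "I = dist c d * integral {0..1} (\<lambda>t. g (linepath c d t))" by blast
    then have "{a, b} = {c, d}" by (simp add: closed_segment_eq)
    then show "I = dist a b * integral {0..1} (\<lambda>t. g (linepath a b t))"
      using I rev[of a b] by (auto simp: doubleton_eq_iff dist_commute)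
  qed blast
qed

definition bubble_space :: "nat \<Rightarrow> plane set \<Rightarrow> tensor_field set" where
  "bubble_space k f =
     {\<sigma> \<in> sym_poly_space k f.
        (\<forall>e\<in>edges_of f. \<forall>t n. unit_tangent e t \<and> unit_normal e n \<longrightarrow>
           (\<forall>x\<in>e. t \<bullet> (\<sigma> x *v t) = 0 \<and> n \<bullet> (\<sigma> x *v n) = 0)) \<and>
        (\<forall>x\<in>verts_of f. \<sigma> x = 0)}"

text \<open>The moment along \<open>e\<close> of the normal-normal or tangent-tangent component of \<open>\<sigma>\<close>.\<close>

definition edge_moment :: "plane set \<Rightarrow> plane \<Rightarrow> (plane \<Rightarrow> real) \<Rightarrow> tensor_field \<Rightarrow> real" where
  "edge_moment e u p \<sigma> = edge_integral e (\<lambda>x. (u \<bullet> (\<sigma> x *v u)) * p x)"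

definition is_basis_of :: "'a::real_vector set \<Rightarrow> 'a set \<Rightarrow> bool" where
  "is_basis_of B V \<longleftrightarrow> independent B \<and> span B = V"

text \<open>Linear forms on a linear subspace \<open>V\<close> are again represented by their extensions by zero.\<close>

definition dual_space :: "'a::real_vector set \<Rightarrow> ('a \<Rightarrow> real) set" where
  "dual_space V =
     {\<phi>. (\<forall>u\<in>V. \<forall>v\<in>V. \<phi> (u + v) = \<phi> u + \<phi> v) \<and>
         (\<forall>c. \<forall>v\<in>V. \<phi> (c *\<^sub>R v) = c * \<phi> v) \<and>
         (\<forall>v. v \<notin> V \<longrightarrow> \<phi> v = 0)}"

definition restrict_form :: "'a set \<Rightarrow> ('a \<Rightarrow> real) \<Rightarrow> 'a \<Rightarrow> real" where
  "restrict_form V \<phi> = (\<lambda>v. if v \<in> V then \<phi> v else 0)"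

text \<open>The indexed family \<open>(L i)\<close>, \<open>i \<in> I\<close>, of linear forms is a basis of the dual of \<open>V\<close>.\<close>

definition unisolvent :: "'a::real_vector set \<Rightarrow> 'i set \<Rightarrow> ('i \<Rightarrow> 'a \<Rightarrow> real) \<Rightarrow> bool" where
  "unisolvent V I L \<longleftrightarrow>
     inj_on (\<lambda>i. restrict_form V (L i)) I \<and>
     is_basis_of ((\<lambda>i. restrict_form V (L i)) ` I) (dual_space V)"

text \<open>The matrix-valued degree of freedom \<open>\<sigma>(x)\<close> at a vertex is resolved into linear forms
  \<open>\<sigma>(x) : M\<close> with \<open>M\<close> ranging over a basis of the symmetric matrices.\<close>

datatype dof_index =
    At_vertex plane mat2
  | Tangential "plane set" "plane \<Rightarrow> real"
  | Normal "plane set" "plane \<Rightarrow> real"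
  | Interior tensor_field

definition dof_indices ::
  "plane set \<Rightarrow> mat2 set \<Rightarrow> (plane set \<Rightarrow> (plane \<Rightarrow> real) set) \<Rightarrow> tensor_field set \<Rightarrow> dof_index set" where
  "dof_indices f S Q B =
     {At_vertex x M | x M. x \<in> verts_of f \<and> M \<in> S} \<union>
     {Tangential e p | e p. e \<in> edges_of f \<and> p \<in> Q e} \<union>
     {Normal e p | e p. e \<in> edges_of f \<and> p \<in> Q e} \<union>
     {Interior b | b. b \<in> B}"

fun dof ::
  "plane set \<Rightarrow> (plane set \<Rightarrow> plane) \<Rightarrow> (plane set \<Rightarrow> plane) \<Rightarrow> dof_index \<Rightarrow> tensor_field \<Rightarrow> real" where
  "dof f \<tau> \<nu> (At_vertex x M) \<sigma> = frob (\<sigma> x) M"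
| "dof f \<tau> \<nu> (Tangential e p) \<sigma> = edge_moment e (\<tau> e) p \<sigma>"
| "dof f \<tau> \<nu> (Normal e p) \<sigma> = edge_moment e (\<nu> e) p \<sigma>"
| "dof f \<tau> \<nu> (Interior b) \<sigma> = integral f (\<lambda>x. frob (\<sigma> x) (b x))"

definition polygonal_domain :: "plane set \<Rightarrow> bool" where
  "polygonal_domain \<Omega> \<longleftrightarrow> open \<Omega> \<and> connected \<Omega> \<and> bounded \<Omega> \<and> \<Omega> \<noteq> {} \<and>
     (\<exists>S. finite S \<and> frontier \<Omega> = (\<Union>(a, b)\<in>S. closed_segment a b))"

text \<open>The library notion \<^const>\<open>triangulation\<close> admits simplices of any dimension; here the
  members of \<open>F\<close> are exactly the triangles of a face-to-face subdivision.\<close>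

definition triangulates :: "plane set set \<Rightarrow> plane set \<Rightarrow> bool" where
  "triangulates F D \<longleftrightarrow> triangulation F \<and> (\<forall>f\<in>F. 2 simplex f) \<and> \<Union>F = D"

definition mesh_verts :: "plane set set \<Rightarrow> plane set" where
  "mesh_verts F = (\<Union>f\<in>F. verts_of f)"

definition mesh_edges :: "plane set set \<Rightarrow> plane set set" where
  "mesh_edges F = (\<Union>f\<in>F. edges_of f)"

text \<open>A piecewise field is a family indexed by the triangles, as its values at a point of an edge
  may differ between the two triangles sharing that edge. Components at indices outside \<open>F\<close> are
  zero. The moments do not depend on the orientation of the unit tangent and normal.\<close>

definition fe_space :: "nat \<Rightarrow> plane set set \<Rightarrow> (plane set \<Rightarrow> tensor_field) set" where
  "fe_space k F =
     {\<sigma>. (\<forall>f\<in>F. \<sigma> f \<in> sym_poly_space k f) \<and> (\<forall>f. f \<notin> F \<longrightarrow> \<sigma> f = 0) \<and>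
         (\<forall>f\<in>F. \<forall>g\<in>F. \<forall>x \<in> verts_of f \<inter> verts_of g. \<sigma> f x = \<sigma> g x) \<and>
         (\<forall>f\<in>F. \<forall>g\<in>F. \<forall>e \<in> edges_of f \<inter> edges_of g. \<forall>t n. unit_tangent e t \<and> unit_normal e n \<longrightarrow>
            (\<forall>p \<in> poly_space (int k - 2) e.
               edge_moment e t p (\<sigma> f) = edge_moment e t p (\<sigma> g) \<and>
               edge_moment e n p (\<sigma> f) = edge_moment e n p (\<sigma> g)))}"

end

theory Submission
  imports Defs "HOL-Computational_Algebra.Polynomial"
begin

text \<open>
  If all vertex values and edge moments of \<open>\<sigma>\<close> vanish, then on each edge \<open>\<tau>\<^sup>T\<sigma>\<tau>\<close> and
  \<open>\<nu>\<^sup>T\<sigma>\<nu>\<close> have the form \<open>t (1 - t) h\<close> with \<open>h\<close> of degree at most \<open>k - 2\<close>; testing against \<open>h\<close>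
  itself gives \<open>h = 0\<close>, so \<open>\<sigma>\<close> lies in the bubble space, and the interior moment against \<open>\<sigma>\<close> finishes.
  Conversely, a vanishing linear combination of the degrees of freedom collects into one matrix per
  vertex, two polynomials per edge and one bubble \<open>b\<close>. Testing it with \<open>b\<close>, then
  with \<open>\<lambda>\<^sub>x \<lambda>\<^sub>y p\<close> times \<open>\<tau>\<tau>\<^sup>T\<close> or \<open>\<nu>\<nu>\<^sup>T\<close> for the polynomial \<open>p\<close> on an edge \<open>xy\<close>, and finally
  with \<open>\<lambda>\<^sub>x M\<close> for the matrix \<open>M\<close> at a vertex \<open>x\<close>, kills these in turn. Hence the number of degrees of
  freedom is \<open>3 (k + 1) (k + 2) / 2\<close>, which gives the dimension \<open>3 k (k - 1) / 2\<close> of the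
  bubble space. Single-valuedness makes the local nodal fields glue to nodal fields of the global space, whose
  dimension is therefore the number of global degrees of freedom.
\<close>

section \<open>Dual families of linear forms\<close>

text \<open>The usual shortcut, trivial kernel plus a count of the forms, is closed off: the count
  contains the dimension of the bubble space, which is not known in advance. So kernel and
  independence are both proved for an arbitrary bubble basis, and its size is read off afterwards
  from the dimension of \<open>sym_poly_space\<close>. Both facts are combined through nodal fields,
  a family dual to the forms: independence produces it, the trivial kernel makes it spanning. The
  mesh uses the same interface, with nodal fields assembled triangle by triangle. The weight t (1 -
  t) links the two halves. It is what splits off from an edge polynomial vanishing at both ends, and
  it is the trace on the edge of the product of two barycentric coordinates, so one positivity
  argument on [0, 1] serves both. Tangential and normal moments decouple because \<tau> and \<nu>
  are orthogonal. For k = 1 the edge weights have degree bound -1, hence are zero and their bases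
  are empty; no case distinction is made.\<close>

lemma sum_fun_apply: "(\<Sum>i\<in>I. f i) x = (\<Sum>i\<in>I. f i x)"
  by (induction I rule: infinite_finite_induct) auto

lemma scaleR_fun_apply [simp]: "(c *\<^sub>R f) x = c *\<^sub>R f x"
  by (simp add: scaleR_fun_def)

text \<open>Linearity is demanded on \<open>V\<close> only, because the moments are additive only
  where the integrands are integrable.\<close>

definition linear_form_on :: "'a::real_vector set \<Rightarrow> ('a \<Rightarrow> real) \<Rightarrow> bool" where
  "linear_form_on V \<phi> \<longleftrightarrow> (\<forall>u\<in>V. \<forall>v\<in>V. \<phi> (u + v) = \<phi> u + \<phi> v) \<and> (\<forall>c. \<forall>v\<in>V. \<phi> (c *\<^sub>R v) = c * \<phi> v)"

lemma linear_form_on_sum: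
  assumes "subspace V" "linear_form_on V \<phi>" "\<And>i. i \<in> I \<Longrightarrow> v i \<in> V"
  shows "\<phi> (\<Sum>i\<in>I. c i *\<^sub>R v i) = (\<Sum>i\<in>I. c i * \<phi> (v i))"
proof -
  have 0: "\<phi> 0 = 0"
    using assms(1,2) subspace_0[OF assms(1)] unfolding linear_form_on_def
    by (metis mult_zero_left scaleR_zero_left)
  show ?thesis
    using assms(3)
  proof (induction I rule: infinite_finite_induct)
    case (insert x F)
    have "(\<Sum>i\<in>F. c i *\<^sub>R v i) \<in> V" "c x *\<^sub>R v x \<in> V"
      using insert assms(1) by (auto intro!: subspace_sum subspace_scale)
    then show ?case
      using insert assms(2) by (simp add: linear_form_on_def)
  qed (auto simp: 0)
qed

lemma linear_form_on_eq_on_span: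
  assumes "span B = V" "linear_form_on V \<phi>" "linear_form_on V \<psi>" "\<And>b. b \<in> B \<Longrightarrow> \<phi> b = \<psi> b" "v \<in> V"
  shows "\<phi> v = \<psi> v"
proof -
  have V: "subspace V" using assms(1) subspace_span by metis
  have B: "B \<subseteq> V" using assms(1) span_superset by metis
  from assms(5) have "v \<in> span B" using assms(1) by simp
  then obtain T r where T: "T \<subseteq> B" and v: "v = (\<Sum>a\<in>T. r a *\<^sub>R a)"
    unfolding span_explicit by blast
  have "\<phi> v = (\<Sum>a\<in>T. r a * \<phi> a)"
    unfolding v by (rule linear_form_on_sum[OF V assms(2)]) (use T B in auto)
  also have "\<dots> = (\<Sum>a\<in>T. r a * \<psi> a)"
    using T assms(4) by (intro sum.cong) auto
  also have "\<dots> = \<psi> v"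
    unfolding v by (rule linear_form_on_sum[OF V assms(3), symmetric]) (use T B in auto)
  finally show ?thesis .
qed

text \<open>The hypothesis concerns the family, not its image: a repeated vector would admit the
  coefficients 1 and -1, so injectivity comes along with independence.\<close>

lemma independent_family:
  fixes v :: "'i \<Rightarrow> 'a::real_vector"
  assumes "finite I" and ind: "\<And>c :: 'i \<Rightarrow> real. (\<Sum>i\<in>I. c i *\<^sub>R v i) = 0 \<Longrightarrow> \<forall>i\<in>I. c i = 0"
  shows "inj_on v I" "independent (v ` I)"
proof -
  show inj: "inj_on v I"
  proof (rule inj_onI, rule ccontr)
    fix i j assume ij: "i \<in> I" "j \<in> I" "v i = v j" "i \<noteq> j"
    have "(\<Sum>l\<in>I. (of_bool (l = i) - of_bool (l = j)) *\<^sub>R v l)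
        = (\<Sum>l\<in>I. (if l = i then v l else 0) - (if l = j then v l else 0))"
      by (intro sum.cong) auto
    also have "\<dots> = 0"
      using ij assms(1) by (simp add: sum_subtractf sum.delta)
    finally show False
      using ind[of "\<lambda>l. of_bool (l = i) - of_bool (l = j)"] ij by auto
  qed
  show "independent (v ` I)"
  proof (rule independent_if_scalars_zero)
    fix f x assume "(\<Sum>x\<in>v ` I. f x *\<^sub>R x) = 0" "x \<in> v ` I"
    then show "f x = 0"
      using ind[of "f \<circ> v"] inj by (auto simp: sum.reindex)
  qed (use assms in auto)
qed

lemma dim_span_family:
  fixes v :: "'i \<Rightarrow> 'a::real_vector"
  assumes "finite I" and "\<And>c :: 'i \<Rightarrow> real. (\<Sum>i\<in>I. c i *\<^sub>R v i) = 0 \<Longrightarrow> \<forall>i\<in>I. c i = 0"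
  shows "dim (span (v ` I)) = card I"
  by (simp only: dim_span_eq_card_independent[OF independent_family(2)[where v = v, OF assms]]
      card_image[OF independent_family(1)[where v = v, OF assms]])

text \<open>Induction over the forms in the manner of Gram-Schmidt. It turns independence of forms
  into vectors without a prior count of the dimension of \<open>V\<close>.\<close>

lemma dual_vectors_exist:
  fixes L :: "'i \<Rightarrow> 'a::real_vector \<Rightarrow> real"
  assumes V: "subspace V" and "finite I" and "\<And>i. i \<in> I \<Longrightarrow> linear_form_on V (L i)"
    and "\<And>c. (\<And>v. v \<in> V \<Longrightarrow> (\<Sum>i\<in>I. c i * L i v) = 0) \<Longrightarrow> \<forall>i\<in>I. c i = 0"
  shows "\<exists>w. \<forall>i\<in>I. w i \<in> V \<and> (\<forall>j\<in>I. L j (w i) = of_bool (i = j))"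
  using assms(2-4)
proof (induction I rule: finite_induct)
  case empty
  then show ?case by simp
next
  case (insert a J)
  \<comment> \<open>A relation among the forms of \<open>J\<close> extends by the coefficient 0 at
    \<open>a\<close>, so the independence hypothesis is inherited.\<close>
  have "\<exists>w. \<forall>i\<in>J. w i \<in> V \<and> (\<forall>j\<in>J. L j (w i) = of_bool (i = j))"
  proof (rule insert.IH)
    fix c assume c: "\<And>v. v \<in> V \<Longrightarrow> (\<Sum>i\<in>J. c i * L i v) = 0"
    have "\<forall>i\<in>insert a J. (c(a := 0)) i = 0"
    proof (rule insert.prems(2)[of "c(a := 0)"])
      fix v assume v: "v \<in> V"
      have "(\<Sum>i\<in>J. (c(a := 0)) i * L i v) = (\<Sum>i\<in>J. c i * L i v)"
        using insert.hyps by (intro sum.cong) auto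
      then show "(\<Sum>i\<in>insert a J. (c(a := 0)) i * L i v) = 0"
        using insert.hyps c[OF v] by simp
    qed
    then show "\<forall>i\<in>J. c i = 0" using insert.hyps by (auto split: if_splits)
  qed (use insert.prems in auto)
  then obtain w where w: "\<And>i. i \<in> J \<Longrightarrow> w i \<in> V"
    "\<And>i j. i \<in> J \<Longrightarrow> j \<in> J \<Longrightarrow> L j (w i) = of_bool (i = j)" by blast
  have L: "\<And>i. i \<in> insert a J \<Longrightarrow> linear_form_on V (L i)" by fact
  \<comment> \<open>the projection along the dual vectors of \<open>J\<close> onto their common kernel, where \<open>L a\<close> cannot vanish\<close>
  define P where "P v = v + (\<Sum>i\<in>J. (- L i v) *\<^sub>R w i)" for v
  have PV: "P v \<in> V" if "v \<in> V" for v
    unfolding P_def using V w that by (auto intro!: subspace_add subspace_sum subspace_neg subspace_scale)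
  have LP: "L j (P v) = L j v - (\<Sum>i\<in>J. L i v * L j (w i))" if "v \<in> V" "j \<in> insert a J" for j v
  proof -
    have "(\<Sum>i\<in>J. (- L i v) *\<^sub>R w i) \<in> V"
      using V w by (auto intro!: subspace_sum subspace_neg subspace_scale)
    then have "L j (P v) = L j v + L j (\<Sum>i\<in>J. (- L i v) *\<^sub>R w i)"
      unfolding P_def using L that by (simp add: linear_form_on_def)
    then show ?thesis
      using linear_form_on_sum[OF V L[OF that(2)], of J w "\<lambda>i. - L i v"] w
      by (simp add: sum_negf)
  qed
  have LPJ: "L j (P v) = 0" if "v \<in> V" "j \<in> J" for j v
  proof -
    have "(\<Sum>i\<in>J. L i v * L j (w i)) = (\<Sum>i\<in>J. if j = i then L i v else 0)"
      using that w by (intro sum.cong) auto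
    then show ?thesis
      using LP[of v j] that insert.hyps by (simp add: sum.delta)
  qed
  have "\<exists>v\<in>V. L a (P v) \<noteq> 0"
  proof (rule ccontr)
    assume "\<not> ?thesis"
    then have *: "L a v - (\<Sum>i\<in>J. L i v * L a (w i)) = 0" if "v \<in> V" for v
      using LP[of v a] that by simp
    \<comment> \<open>Otherwise \<open>L a\<close> is the combination of the other forms with
      coefficients \<open>L a (w i)\<close>; the resulting relation has coefficient 1 at
      \<open>a\<close>.\<close>
    have "\<forall>i\<in>insert a J. (if i = a then 1 else - L a (w i)) = 0"
    proof (rule insert.prems(2)[of "\<lambda>i. if i = a then 1 else - L a (w i)"])
      fix v assume v: "v \<in> V"
      have "(\<Sum>i\<in>J. (if i = a then 1 else - L a (w i)) * L i v) = - (\<Sum>i\<in>J. L i v * L a (w i))"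
        unfolding sum_negf[symmetric] using insert.hyps by (intro sum.cong) auto
      then show "(\<Sum>i\<in>insert a J. (if i = a then 1 else - L a (w i)) * L i v) = 0"
        using insert.hyps *[OF v] by simp
    qed
    then show False by simp
  qed
  then obtain v where v: "v \<in> V" "L a (P v) \<noteq> 0" by blast
  define z where "z = (1 / L a (P v)) *\<^sub>R P v"
  have z: "z \<in> V" "L a z = 1" "\<And>j. j \<in> J \<Longrightarrow> L j z = 0"
    using v PV[OF v(1)] L LPJ[OF v(1)] V unfolding z_def
    by (auto simp: linear_form_on_def intro!: subspace_scale)
  \<comment> \<open>Subtracting a multiple of \<open>z\<close> clears the value under
    \<open>L a\<close> and keeps the other values, since the forms of \<open>J\<close> vanish at
    \<open>z\<close>.\<close>
  define w' where "w' i = (if i = a then z else w i + (- L a (w i)) *\<^sub>R z)" for i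
  have L_add: "L j (w i + c *\<^sub>R z) = L j (w i) + c * L j z" if "i \<in> J" "j \<in> insert a J" for i j c
    using L[OF that(2)] w(1)[OF that(1)] z(1) V
    by (simp add: linear_form_on_def subspace_scale del: insert_iff)
  have "w' i \<in> V \<and> (\<forall>j\<in>insert a J. L j (w' i) = of_bool (i = j))" if i: "i \<in> insert a J" for i
  proof (cases "i = a")
    case True
    then show ?thesis using z insert.hyps by (auto simp: w'_def)
  next
    case False
    then have "i \<in> J" using i by simp
    have "L j (w' i) = of_bool (i = j)" if "j \<in> insert a J" for j
      using L_add[OF \<open>i \<in> J\<close> that] z w \<open>i \<in> J\<close> False that
      by (cases "j = a") (simp_all add: w'_def del: scaleR_minus_left add_uminus_conv_diff)
    moreover have "w' i \<in> V"
      using z w \<open>i \<in> J\<close> False V unfolding w'_def by (simp add: subspace_diff subspace_scale)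
    ultimately show ?thesis by blast
  qed
  then show ?case by blast
qed

text \<open>Every form of the family vanishes on the difference of the two sides, and the common
  kernel is trivial.\<close>

lemma expansion_in_dual_vectors:
  assumes V: "subspace V" and "finite I" and L: "\<And>i. i \<in> I \<Longrightarrow> linear_form_on V (L i)"
    and ker: "\<And>v. v \<in> V \<Longrightarrow> (\<And>i. i \<in> I \<Longrightarrow> L i v = 0) \<Longrightarrow> v = 0"
    and w: "\<And>i. i \<in> I \<Longrightarrow> w i \<in> V" "\<And>i j. i \<in> I \<Longrightarrow> j \<in> I \<Longrightarrow> L j (w i) = of_bool (i = j)"
    and v: "v \<in> V"
  shows "v = (\<Sum>i\<in>I. L i v *\<^sub>R w i)"
proof -
  define s where "s = (\<Sum>i\<in>I. (- L i v) *\<^sub>R w i)"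
  have s: "s \<in> V" unfolding s_def using V w by (auto intro!: subspace_sum subspace_neg subspace_scale)
  have "v + s = 0"
  proof (rule ker)
    show "v + s \<in> V" using V v s by (rule subspace_add)
    fix j assume j: "j \<in> I"
    have "L j s = (\<Sum>i\<in>I. if j = i then - L i v else 0)"
      unfolding s_def using linear_form_on_sum[OF V L[OF j], of I w "\<lambda>i. - L i v"] w j
      by (auto intro!: sum.cong)
    then show "L j (v + s) = 0"
      using L[OF j] v s j \<open>finite I\<close> by (simp add: linear_form_on_def sum.delta)
  qed
  then show ?thesis unfolding s_def by (simp add: sum_negf eq_neg_iff_add_eq_0[symmetric])
qed

lemma independent_dual_vectors:
  assumes V: "subspace V" and "finite I" and L: "\<And>i. i \<in> I \<Longrightarrow> linear_form_on V (L i)"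
    and w: "\<And>i. i \<in> I \<Longrightarrow> w i \<in> V" "\<And>i j. i \<in> I \<Longrightarrow> j \<in> I \<Longrightarrow> L j (w i) = of_bool (i = j)"
    and c: "(\<Sum>i\<in>I. c i *\<^sub>R w i) = 0" "j \<in> I"
  shows "c j = 0"
proof -
  have "(\<Sum>i\<in>I. c i * L j (w i)) = L j 0"
    using linear_form_on_sum[OF V L[OF c(2)], of I w c] w c by simp
  also have "L j 0 = 0"
    using linear_form_on_sum[OF V L[OF c(2)], of "{}" w c] by simp
  also have "(\<Sum>i\<in>I. c i * L j (w i)) = (\<Sum>i\<in>I. if j = i then c i else 0)"
    using c w by (intro sum.cong) auto
  finally show ?thesis using c \<open>finite I\<close> by (simp add: sum.delta)
qed

lemma dim_eq_card_forms:
  assumes V: "subspace V" and "finite I" and L: "\<And>i. i \<in> I \<Longrightarrow> linear_form_on V (L i)"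
    and ker: "\<And>v. v \<in> V \<Longrightarrow> (\<And>i. i \<in> I \<Longrightarrow> L i v = 0) \<Longrightarrow> v = 0"
    and w: "\<And>i. i \<in> I \<Longrightarrow> w i \<in> V" "\<And>i j. i \<in> I \<Longrightarrow> j \<in> I \<Longrightarrow> L j (w i) = of_bool (i = j)"
  shows "dim V = card I"
proof -
  have "span (w ` I) = V"
  proof
    show "span (w ` I) \<subseteq> V" by (rule span_minimal[OF _ V]) (use w in auto)
    show "V \<subseteq> span (w ` I)"
    proof
      fix v assume "v \<in> V"
      then have "v = (\<Sum>i\<in>I. L i v *\<^sub>R w i)"
        using expansion_in_dual_vectors[OF V \<open>finite I\<close> L ker w] by blast
      also have "\<dots> \<in> span (w ` I)" by (rule span_sum, rule span_scale, rule span_base) simp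
      finally show "v \<in> span (w ` I)" .
    qed
  qed
  moreover have "dim (span (w ` I)) = card I"
    by (rule dim_span_family[OF \<open>finite I\<close>]) (use independent_dual_vectors[OF V \<open>finite I\<close> L w] in blast)
  ultimately show ?thesis by simp
qed

text \<open>Evaluating a relation at \<open>w j\<close> isolates its coefficient at
  \<open>j\<close>. Applying a form \<open>\<phi>\<close> to the expansion of a vector shows that
  \<open>\<phi>\<close> has the coordinates \<open>\<phi> (w i)\<close>.\<close>

lemma unisolvent_if_dual_vectors:
  assumes V: "subspace V" and "finite I" and L: "\<And>i. i \<in> I \<Longrightarrow> linear_form_on V (L i)"
    and ker: "\<And>v. v \<in> V \<Longrightarrow> (\<And>i. i \<in> I \<Longrightarrow> L i v = 0) \<Longrightarrow> v = 0"
    and w: "\<And>i. i \<in> I \<Longrightarrow> w i \<in> V" "\<And>i j. i \<in> I \<Longrightarrow> j \<in> I \<Longrightarrow> L j (w i) = of_bool (i = j)"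
  shows "unisolvent V I L"
proof -
  define R where "R i = restrict_form V (L i)" for i
  have R: "R i v = (if v \<in> V then L i v else 0)" for i v by (simp add: R_def restrict_form_def)
  have ind: "\<forall>j\<in>I. c j = 0" if "(\<Sum>i\<in>I. c i *\<^sub>R R i) = 0" for c
  proof
    fix j assume j: "j \<in> I"
    have "(\<Sum>i\<in>I. c i *\<^sub>R R i) (w j) = (\<Sum>i\<in>I. if j = i then c i else 0)"
      using j w by (auto simp: sum_fun_apply R intro!: sum.cong)
    then show "c j = 0" using that j \<open>finite I\<close> by (simp add: sum.delta)
  qed
  have D: "subspace (dual_space V)"
    unfolding subspace_def dual_space_def by (auto simp: algebra_simps)
  have "R i \<in> dual_space V" if "i \<in> I" for i
    using L[OF that] V unfolding dual_space_def linear_form_on_def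
    by (auto simp: R subspace_add subspace_scale)
  then have "span (R ` I) \<subseteq> dual_space V"
    by (intro span_minimal[OF _ D]) auto
  moreover have "dual_space V \<subseteq> span (R ` I)"
  proof
    fix \<phi> assume \<phi>: "\<phi> \<in> dual_space V"
    then have l: "linear_form_on V \<phi>" by (auto simp: dual_space_def linear_form_on_def)
    have "\<phi> = (\<Sum>i\<in>I. \<phi> (w i) *\<^sub>R R i)"
    proof
      fix v show "\<phi> v = (\<Sum>i\<in>I. \<phi> (w i) *\<^sub>R R i) v"
      proof (cases "v \<in> V")
        case True
        have "v = (\<Sum>i\<in>I. L i v *\<^sub>R w i)"
          using expansion_in_dual_vectors[OF V \<open>finite I\<close> L ker w True] by blast
        then have "\<phi> v = \<phi> (\<Sum>i\<in>I. L i v *\<^sub>R w i)"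
          by (rule arg_cong)
        also have "\<dots> = (\<Sum>i\<in>I. L i v * \<phi> (w i))"
          by (rule linear_form_on_sum[OF V l]) (use w in auto)
        finally show ?thesis using True by (simp add: sum_fun_apply R mult.commute)
      next
        case False
        then show ?thesis using \<phi> by (simp add: sum_fun_apply R dual_space_def)
      qed
    qed
    also have "\<dots> \<in> span (R ` I)" by (rule span_sum, rule span_scale, rule span_base) simp
    finally show "\<phi> \<in> span (R ` I)" .
  qed
  ultimately show ?thesis
    using independent_family[where v = R, OF \<open>finite I\<close> ind] unfolding unisolvent_def is_basis_of_def R_def[symmetric]
    by auto
qed

section \<open>Polynomials on segments and on plane sets\<close>

definition monomial_on :: "plane set \<Rightarrow> nat \<times> nat \<Rightarrow> plane \<Rightarrow> real" where
  "monomial_on s = (\<lambda>(i, j) x. if x \<in> s then (x $ 1) ^ i * (x $ 2) ^ j else 0)"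

lemma monomial_on_apply: "monomial_on s (i, j) x = (if x \<in> s then (x $ 1) ^ i * (x $ 2) ^ j else 0)"
  by (simp add: monomial_on_def)

lemma poly_space_eq_span: "poly_space m s = span (monomial_on s ` {(i, j). int (i + j) \<le> m})"
  unfolding poly_space_def by (rule arg_cong[where f = span]) (auto simp: monomial_on_def image_iff)

lemma subspace_poly_space [intro, simp]: "subspace (poly_space m s)"
  by (simp add: poly_space_eq_span)

lemma zero_mem_poly_space [simp]: "(\<lambda>x. 0) \<in> poly_space m s"
  using subspace_0[OF subspace_poly_space] by (simp add: zero_fun_def)

lemma add_mem_poly_space:
  "p \<in> poly_space m s \<Longrightarrow> q \<in> poly_space m s \<Longrightarrow> (\<lambda>x. p x + q x) \<in> poly_space m s"
  using subspace_add[OF subspace_poly_space] by (fastforce simp: plus_fun_def)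

lemma scale_mem_poly_space: "p \<in> poly_space m s \<Longrightarrow> (\<lambda>x. c * p x) \<in> poly_space m s"
  using subspace_scale[OF subspace_poly_space, of p m s c] by (simp add: scaleR_fun_def)

lemma poly_space_induct [consumes 1, case_names zero add monomial]:
  assumes "p \<in> poly_space m s"
    and "P (\<lambda>x. 0)" and "\<And>c p q. P p \<Longrightarrow> P q \<Longrightarrow> P (\<lambda>x. c * p x + q x)"
    and "\<And>i j. int (i + j) \<le> m \<Longrightarrow> P (monomial_on s (i, j))"
  shows "P p"
  using assms(1) unfolding poly_space_eq_span
proof (induction rule: span_induct_alt)
  case base
  show ?case using assms(2) by (simp add: zero_fun_def)
next
  case (step c x y)
  then have "P (\<lambda>z. c * x z + y z)" using assms(3,4) by auto
  then show ?case by (simp add: scaleR_fun_def plus_fun_def)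
qed

lemma monomial_on_mem: "int (i + j) \<le> m \<Longrightarrow> monomial_on s (i, j) \<in> poly_space m s"
  unfolding poly_space_eq_span by (rule span_base) auto

lemma const_mem_poly_space: "0 \<le> m \<Longrightarrow> (\<lambda>x. if x \<in> s then c else 0) \<in> poly_space m s"
  using scale_mem_poly_space[OF monomial_on_mem[of 0 0 m s], of c]
  by (simp add: monomial_on_def if_distrib cong: if_cong)

lemma poly_space_outside: "p \<in> poly_space m s \<Longrightarrow> x \<notin> s \<Longrightarrow> p x = 0"
  by (induction rule: poly_space_induct) (auto simp: monomial_on_def)

lemma poly_space_continuous: "p \<in> poly_space m s \<Longrightarrow> continuous_on s p"
proof (induction rule: poly_space_induct)
  case (monomial i j)
  have "continuous_on s (\<lambda>x::plane. (x $ 1) ^ i * (x $ 2) ^ j)"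
    by (intro continuous_intros)
  then show ?case
    by (rule continuous_on_eq) (simp add: monomial_on_def)
qed (auto intro!: continuous_intros)

lemma poly_space_mono: "m \<le> n \<Longrightarrow> p \<in> poly_space m s \<Longrightarrow> p \<in> poly_space n s"
  unfolding poly_space_eq_span using span_mono[OF image_mono] by (smt (verit) Collect_mono_iff case_prod_beta subset_eq)

lemma poly_space_restrict:
  assumes "t \<subseteq> s" "p \<in> poly_space m s"
  shows "(\<lambda>x. if x \<in> t then p x else 0) \<in> poly_space m t"
  using assms(2)
proof (induction rule: poly_space_induct)
  case (add c p q)
  have "(\<lambda>x. if x \<in> t then c * p x + q x else 0)
      = (\<lambda>x. c * (if x \<in> t then p x else 0) + (if x \<in> t then q x else 0))" by auto
  then show ?case using add by (auto intro!: add_mem_poly_space scale_mem_poly_space)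
next
  case (monomial i j)
  have "(\<lambda>x. if x \<in> t then monomial_on s (i, j) x else 0) = monomial_on t (i, j)"
    using assms(1) by (intro ext) (auto simp: monomial_on_apply)
  then show ?case using monomial by (simp add: monomial_on_mem)
qed auto

text \<open>A monomial on \<open>t\<close> is the restriction of the same monomial on
  \<open>s\<close>, so the degree bound is kept. This lifts an edge polynomial to the
  triangle.\<close>

lemma poly_space_extend:
  assumes "t \<subseteq> s" "p \<in> poly_space m t"
  shows "\<exists>q\<in>poly_space m s. \<forall>x\<in>t. q x = p x"
  using assms(2)
proof (induction rule: poly_space_induct)
  case zero
  show ?case by (rule bexI[of _ "\<lambda>x. 0"]) auto
next
  case (add c p q)
  then obtain p' q' where "p' \<in> poly_space m s" "q' \<in> poly_space m s"
    "\<forall>x\<in>t. p' x = p x" "\<forall>x\<in>t. q' x = q x" by blast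
  then show ?case
    by (intro bexI[of _ "\<lambda>x. c * p' x + q' x"]) (auto intro!: add_mem_poly_space scale_mem_poly_space)
next
  case (monomial i j)
  then show ?case
    using assms(1) by (intro bexI[of _ "monomial_on s (i, j)"]) (auto simp: monomial_on_apply monomial_on_mem)
qed

lemma coord_mult_mem_poly_space:
  assumes "p \<in> poly_space m s"
  shows "(\<lambda>x. x $ i * p x) \<in> poly_space (m + 1) s"
  using assms
proof (induction rule: poly_space_induct)
  case (add c p q)
  have "(\<lambda>x. x $ i * (c * p x + q x)) = (\<lambda>x. c * (x $ i * p x) + x $ i * q x)"
    by (auto simp: algebra_simps)
  then show ?case using add by (auto intro!: add_mem_poly_space scale_mem_poly_space)
next
  case (monomial j l)
  have "i = 1 \<or> i = 2" by (rule exhaust_2)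
  then have "(\<lambda>x. x $ i * monomial_on s (j, l) x) = monomial_on s (if i = 1 then (Suc j, l) else (j, Suc l))"
    by (auto simp: monomial_on_def)
  then show ?case using monomial by (auto intro!: monomial_on_mem)
qed simp

text \<open>The common class of edge parameters and barycentric coordinates; a factor of this kind
  costs one degree.\<close>

definition affine_fun :: "(plane \<Rightarrow> real) \<Rightarrow> bool" where
  "affine_fun l \<longleftrightarrow> (\<exists>\<alpha> \<beta> \<gamma>. \<forall>x. l x = \<alpha> + \<beta> * x $ 1 + \<gamma> * x $ 2)"

lemma affine_mult_mem_poly_space:
  assumes "affine_fun l" "p \<in> poly_space m s"
  shows "(\<lambda>x. l x * p x) \<in> poly_space (m + 1) s"
proof -
  obtain \<alpha> \<beta> \<gamma> where l: "l x = \<alpha> + \<beta> * x $ 1 + \<gamma> * x $ 2" for x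
    using assms(1) unfolding affine_fun_def by blast
  have "(\<lambda>x. l x * p x) = (\<lambda>x. (\<alpha> * p x + \<beta> * (x $ 1 * p x)) + \<gamma> * (x $ 2 * p x))"
    by (auto simp: l algebra_simps)
  then show ?thesis
    using assms(2)
    by (auto intro!: add_mem_poly_space scale_mem_poly_space coord_mult_mem_poly_space
        intro: poly_space_mono[of m])
qed

section \<open>Zero criteria, and dimension on sets with interior\<close>

lemma poly_eq_0_if_infinite_roots:
  fixes p :: "real poly"
  assumes "infinite A" "\<And>x. x \<in> A \<Longrightarrow> poly p x = 0"
  shows "p = 0"
  using poly_roots_finite[of p] finite_subset[of A "{x. poly p x = 0}"] assms by blast

text \<open>For fixed \<open>x\<close> the sum is a polynomial in \<open>y\<close> with infinitely
  many roots, so its coefficients vanish; these are polynomials in \<open>x\<close> with infinitely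
  many roots in turn.\<close>

lemma coeff_eq_0_if_bivariate_zero:
  assumes K: "finite K" and A: "infinite A" and B: "infinite B"
    and z: "\<And>x y. x \<in> A \<Longrightarrow> y \<in> B \<Longrightarrow> (\<Sum>(i, j)\<in>K. c (i, j) * (x ^ i * y ^ j)) = (0::real)"
    and ij: "(i, j) \<in> K"
  shows "c (i, j) = 0"
proof -
  \<comment> \<open>The coefficient of the power \<open>j\<close> of the second variable, as a
    polynomial in the first.\<close>
  define R where "R = (\<Sum>u\<in>K. if snd u = j then monom (c u) (fst u) else 0)"
  have "poly R x = 0" if x: "x \<in> A" for x
  proof -
    define Q where "Q = (\<Sum>u\<in>K. monom (c u * x ^ fst u) (snd u))"
    have "poly Q y = 0" if "y \<in> B" for y
      using z[OF x that] by (simp add: Q_def poly_sum poly_monom case_prod_beta mult.assoc)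
    then have "Q = 0" using B poly_eq_0_if_infinite_roots by blast
    then have "0 = coeff Q j" by simp
    also have "\<dots> = poly R x"
      unfolding Q_def R_def coeff_sum poly_sum by (intro sum.cong) (auto simp: poly_monom)
    finally show ?thesis by simp
  qed
  then have "R = 0" using A poly_eq_0_if_infinite_roots by blast
  then have "0 = coeff R i" by simp
  also have "\<dots> = (\<Sum>u\<in>K. if (i, j) = u then c u else 0)"
    unfolding R_def coeff_sum by (intro sum.cong) auto
  finally show ?thesis using K ij by (simp add: sum.delta)
qed

lemma finite_pairs_le: "finite {(i, j). i + j \<le> (k::nat)}"
  by (rule finite_subset[of _ "{..k} \<times> {..k}"]) auto

text \<open>Doubled to avoid division of naturals; the induction step adds the antidiagonal
  \<open>i + j = Suc k\<close>.\<close>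

lemma card_pairs_le: "2 * card {(i, j). i + j \<le> (k::nat)} = (k + 1) * (k + 2)"
proof (induction k)
  case 0
  have "{(i, j). i + j \<le> (0::nat)} = {(0, 0)}" by auto
  then show ?case by simp
next
  case (Suc k)
  have "{(i, j). i + j \<le> Suc k} = {(i, j). i + j \<le> k} \<union> (\<lambda>i. (i, Suc k - i)) ` {..Suc k}"
    by (auto simp: image_iff)
  moreover have "card ((\<lambda>i. (i, Suc k - i)) ` {..Suc k}) = k + 2"
    by (subst card_image) (auto simp: inj_on_def)
  moreover have "{(i, j). i + j \<le> k} \<inter> (\<lambda>i. (i, Suc k - i)) ` {..Suc k} = {}" by auto
  ultimately have "card {(i, j). i + j \<le> Suc k} = card {(i, j). i + j \<le> k} + (k + 2)"
    using finite_pairs_le[of k] card_Un_disjoint[of "{(i, j). i + j \<le> k}" "(\<lambda>i. (i, Suc k - i)) ` {..Suc k}"]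
    by auto
  then show ?case using Suc by simp
qed

text \<open>A box inside \<open>f\<close> contains a product of two open intervals, and vanishing
  there already kills all coefficients.\<close>

lemma dim_poly_space_interior:
  assumes "interior f \<noteq> {}"
  shows "2 * dim (poly_space (int k) f) = (k + 1) * (k + 2)"
    and "\<exists>B. finite B \<and> is_basis_of B (poly_space (int k) f)"
proof -
  let ?K = "{(i, j). i + j \<le> k}"
  obtain z a b where box: "z \<in> box a b" "box a b \<subseteq> f"
    using assms open_contains_box[of "interior f"] interior_subset[of f] by (metis all_not_in_conv open_interior subset_trans)
  then have ab: "a $ i < b $ i" for i
    by (auto simp: mem_box_cart intro: less_trans)
  have ind: "\<forall>u\<in>?K. c u = 0" if c: "(\<Sum>u\<in>?K. c u *\<^sub>R monomial_on f u) = 0" for c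
  proof -
    have "(\<Sum>(i, j)\<in>?K. c (i, j) * (x ^ i * y ^ j)) = 0"
      if "x \<in> {a $ 1<..<b $ 1}" "y \<in> {a $ 2<..<b $ 2}" for x y
    proof -
      have "(vector [x, y] :: plane) \<in> f"
        using that box(2) by (force simp: mem_box_cart forall_2)
      moreover have "(\<Sum>u\<in>?K. c u *\<^sub>R monomial_on f u) (vector [x, y]) = 0"
        using c by simp
      ultimately show ?thesis
        by (simp add: sum_fun_apply monomial_on_def case_prod_beta)
    qed
    then have "c (i, j) = 0" if "(i, j) \<in> ?K" for i j
      using coeff_eq_0_if_bivariate_zero[OF finite_pairs_le _ _ _ that]
        infinite_Ioo[OF ab[of 1]] infinite_Ioo[OF ab[of 2]] by blast
    then show ?thesis by auto
  qed
  have sp: "poly_space (int k) f = span (monomial_on f ` ?K)"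
    by (simp add: poly_space_eq_span flip: of_nat_add)
  show "2 * dim (poly_space (int k) f) = (k + 1) * (k + 2)"
    unfolding sp using dim_span_family[where v = "monomial_on f", OF finite_pairs_le ind] card_pairs_le[of k] by simp
  show "\<exists>B. finite B \<and> is_basis_of B (poly_space (int k) f)"
    unfolding is_basis_of_def sp using independent_family(2)[where v = "monomial_on f", OF finite_pairs_le ind] finite_pairs_le by blast
qed

section \<open>Polynomials on a segment as polynomials in one variable\<close>

definition edge_param :: "plane \<Rightarrow> plane \<Rightarrow> plane \<Rightarrow> real" where
  "edge_param a b x = (x - a) \<bullet> (b - a) / ((b - a) \<bullet> (b - a))"

lemma edge_param_linepath [simp]: "a \<noteq> b \<Longrightarrow> edge_param a b (linepath a b t) = t"
proof -
  have "linepath a b t - a = t *\<^sub>R (b - a)" by (simp add: linepath_def algebra_simps)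
  then show "edge_param a b (linepath a b t) = t" if "a \<noteq> b"
    using that by (simp add: edge_param_def)
qed

text \<open>Defining the parameter by orthogonal projection makes it affine on the whole plane, so
  its powers restrict from bivariate polynomials.\<close>

lemma affine_fun_edge_param: "affine_fun (edge_param a b)"
proof -
  define d where "d = b - a"
  have "edge_param a b x = (- (a \<bullet> d) / (d \<bullet> d)) + (d $ 1 / (d \<bullet> d)) * x $ 1 + (d $ 2 / (d \<bullet> d)) * x $ 2" for x
    by (simp add: edge_param_def inner_diff_left inner_vec_def[of x] sum_2 add_divide_distrib
        diff_divide_distrib mult.commute flip: d_def)
  then show ?thesis unfolding affine_fun_def by blast
qed

lemma closed_segmentE_linepath:
  assumes "x \<in> closed_segment a b" obtains t where "t \<in> {0..1}" "x = linepath a b t"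
  using assms by (auto simp: linepath_def in_segment)

lemma linepath_mem_segment [simp]: "t \<in> {0..1} \<Longrightarrow> linepath a b t \<in> closed_segment a b"
  using linepath_in_path by blast

text \<open>The zero polynomial is listed separately because its \<open>degree\<close> is 0 while
  \<open>m\<close> may be negative.\<close>

definition deg_le :: "int \<Rightarrow> real poly \<Rightarrow> bool" where
  "deg_le m P \<longleftrightarrow> P = 0 \<or> int (degree P) \<le> m"

text \<open>The bridge from restrictions of bivariate polynomials to univariate ones, on which
  factoring and root counting are available.\<close>

lemma poly_space_segment_iff:
  assumes "a \<noteq> b"
  shows "p \<in> poly_space m (closed_segment a b) \<longleftrightarrow>
    (\<exists>P. deg_le m P \<and> p = (\<lambda>x. if x \<in> closed_segment a b then poly P (edge_param a b x) else 0))"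
    (is "?l p \<longleftrightarrow> ?r p")
proof
  assume "?l p" then show "?r p"
  proof (induction rule: poly_space_induct)
    case zero
    show ?case by (rule exI[of _ 0]) (auto simp: deg_le_def)
  next
    case (add c p q)
    then obtain P Q where "deg_le m P" "deg_le m Q"
      "p = (\<lambda>x. if x \<in> closed_segment a b then poly P (edge_param a b x) else 0)"
      "q = (\<lambda>x. if x \<in> closed_segment a b then poly Q (edge_param a b x) else 0)" by blast
    moreover from this have "deg_le m (smult c P + Q)"
      using degree_add_le_max[of "smult c P" Q] degree_smult_le[of c P] unfolding deg_le_def by auto
    ultimately show ?case by (intro exI[of _ "smult c P + Q"]) auto
  next
    case (monomial i j)
    \<comment> \<open>The two linear factors are the coordinates of \<open>linepath a b t\<close> as
      polynomials in \<open>t\<close>.\<close>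
    let ?P = "[:a $ 1, (b - a) $ 1:] ^ i * [:a $ 2, (b - a) $ 2:] ^ j"
    have "degree ([:u, v:] ^ n) \<le> n" for u v :: real and n
      using degree_power_le[of "[:u, v:]" n] by (auto split: if_splits)
    then have "degree ?P \<le> i + j"
      by (meson add_mono degree_mult_le order_trans)
    then have "deg_le m ?P" using monomial unfolding deg_le_def by linarith
    moreover have "monomial_on (closed_segment a b) (i, j) =
       (\<lambda>x. if x \<in> closed_segment a b then poly ?P (edge_param a b x) else 0)"
    proof
      fix x show "monomial_on (closed_segment a b) (i, j) x =
         (if x \<in> closed_segment a b then poly ?P (edge_param a b x) else 0)"
      proof (cases "x \<in> closed_segment a b")
        case True
        then obtain t where t: "t \<in> {0..1}" "x = linepath a b t" by (rule closed_segmentE_linepath)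
        have "linepath a b t $ l = a $ l + t * (b - a) $ l" for l
          by (simp add: linepath_def algebra_simps)
        then show ?thesis using t assms by (simp add: monomial_on_def poly_power)
      qed (simp add: monomial_on_def)
    qed
    ultimately show ?case by blast
  qed
next
  let ?e = "closed_segment a b"
  assume "?r p"
  then obtain P where P: "deg_le m P" and p: "p = (\<lambda>x. if x \<in> ?e then poly P (edge_param a b x) else 0)"
    by blast
  have pw: "(\<lambda>x. if x \<in> ?e then edge_param a b x ^ i else 0) \<in> poly_space (int i) ?e" for i
  proof (induction i)
    case 0
    show ?case using const_mem_poly_space[of 0 ?e 1] by (simp cong: if_cong)
  next
    case (Suc i)
    have "(\<lambda>x. if x \<in> ?e then edge_param a b x ^ Suc i else 0)
        = (\<lambda>x. edge_param a b x * (if x \<in> ?e then edge_param a b x ^ i else 0))" by auto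
    then show ?case
      using affine_mult_mem_poly_space[OF affine_fun_edge_param Suc, of a b] by (simp add: add.commute)
  qed
  show "?l p"
  proof (cases "P = 0")
    case True
    then show ?thesis by (simp add: p cong: if_cong)
  next
    case False
    have "p = (\<Sum>i\<le>degree P. coeff P i *\<^sub>R (\<lambda>x. if x \<in> ?e then edge_param a b x ^ i else 0))"
      by (rule ext) (auto simp: p sum_fun_apply poly_altdef)
    also have "\<dots> \<in> poly_space m ?e"
      using P False by (intro subspace_sum subspace_scale subspace_poly_space poly_space_mono[OF _ pw])
        (auto simp: deg_le_def)
    finally show ?thesis .
  qed
qed

text \<open>The bound \<open>int n - 1\<close> makes \<open>n\<close> the dimension and covers
  \<open>n = 0\<close>, the zero space of edge weights for \<open>k = 1\<close>.\<close>

lemma dim_poly_space_segment: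
  assumes "a \<noteq> b"
  shows "dim (poly_space (int n - 1) (closed_segment a b)) = n"
    and "\<exists>B. finite B \<and> is_basis_of B (poly_space (int n - 1) (closed_segment a b))"
proof -
  let ?e = "closed_segment a b"
  define v where "v i = (\<lambda>x. if x \<in> ?e then edge_param a b x ^ i else 0)" for i :: nat
  have ind: "\<forall>i\<in>{..<n}. c i = 0" if c: "(\<Sum>i<n. c i *\<^sub>R v i) = 0" for c
  proof -
    define P where "P = (\<Sum>i<n. monom (c i) i)"
    have "poly P t = 0" if "t \<in> {0..1}" for t
    proof -
      have "(\<Sum>i<n. c i *\<^sub>R v i) (linepath a b t) = 0" using c by simp
      then show ?thesis
        using that assms by (simp add: sum_fun_apply v_def P_def poly_sum poly_monom)
    qed
    then have "P = 0" using poly_eq_0_if_infinite_roots[of "{0..1}"] by (auto simp: infinite_Icc)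
    moreover have "coeff P i = c i" if "i < n" for i
      using that by (simp add: P_def coeff_sum sum.delta)
    ultimately show ?thesis by auto
  qed
  have sp: "poly_space (int n - 1) ?e = span (v ` {..<n})"
  proof
    show "span (v ` {..<n}) \<subseteq> poly_space (int n - 1) ?e"
    proof (rule span_minimal)
      show "v ` {..<n} \<subseteq> poly_space (int n - 1) ?e"
        unfolding poly_space_segment_iff[OF assms] subset_iff
      proof (intro allI impI)
        fix p assume "p \<in> v ` {..<n}"
        then obtain i where "i < n" "p = v i" by auto
        then show "\<exists>P. deg_le (int n - 1) P \<and> p = (\<lambda>x. if x \<in> ?e then poly P (edge_param a b x) else 0)"
          by (intro exI[of _ "monom 1 i"]) (auto simp: deg_le_def degree_monom_eq v_def poly_monom)
      qed
    qed simp
    show "poly_space (int n - 1) ?e \<subseteq> span (v ` {..<n})"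
    proof
      fix p assume "p \<in> poly_space (int n - 1) ?e"
      then obtain P where P: "deg_le (int n - 1) P"
        and p: "p = (\<lambda>x. if x \<in> ?e then poly P (edge_param a b x) else 0)"
        unfolding poly_space_segment_iff[OF assms] by blast
      have "poly P t = (\<Sum>i<n. coeff P i * t ^ i)" for t
      proof -
        have "P = (\<Sum>i<n. monom (coeff P i) i)"
        proof (rule poly_eqI)
          fix j
          have "coeff P j = 0" if "\<not> j < n"
            using P that by (cases "P = 0") (auto simp: deg_le_def intro!: coeff_eq_0)
          then show "coeff P j = coeff (\<Sum>i<n. monom (coeff P i) i) j"
            by (auto simp: coeff_sum sum.delta)
        qed
        then have "poly P t = poly (\<Sum>i<n. monom (coeff P i) i) t" by simp
        then show ?thesis by (simp add: poly_sum poly_monom)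
      qed
      then have "p = (\<Sum>i<n. coeff P i *\<^sub>R v i)"
        by (intro ext) (auto simp: p v_def sum_fun_apply)
      also have "\<dots> \<in> span (v ` {..<n})"
        by (rule span_sum, rule span_scale, rule span_base) simp
      finally show "p \<in> span (v ` {..<n})" .
    qed
  qed
  show "dim (poly_space (int n - 1) ?e) = n"
    unfolding sp using dim_span_family[of "{..<n}" v, OF _ ind] by simp
  show "\<exists>B. finite B \<and> is_basis_of B (poly_space (int n - 1) (closed_segment a b))"
    unfolding is_basis_of_def sp using independent_family(2)[of "{..<n}" v, OF _ ind]
    by (intro exI[of _ "v ` {..<n}"]) auto
qed

section \<open>Edge polynomials and the weight t (1 - t)\<close>

lemma poly_eq_0_if_weighted_square_integral_0:
  fixes P :: "real poly"
  assumes "integral {0..1} (\<lambda>t. t * (1 - t) * (poly P t)\<^sup>2) = 0"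
  shows "P = 0"
proof -
  have "t * (1 - t) * (poly P t)\<^sup>2 = 0" if "t \<in> {0..1}" for t
  proof -
    have "continuous_on {0..1} (\<lambda>t. t * (1 - t) * (poly P t)\<^sup>2)"
      by (intro continuous_intros)
    then show ?thesis
      using integral_cbox_eq_0_iff[of 0 "1::real" "\<lambda>t. t * (1 - t) * (poly P t)\<^sup>2"] assms that by auto
  qed
  then have "poly P t = 0" if "t \<in> {0<..<1}" for t
    using that by (force dest!: spec[of _ t])
  then show ?thesis
    using poly_eq_0_if_infinite_roots[of "{0<..<1}" P] infinite_Ioo[of 0 "1::real"] by simp
qed

text \<open>The form needed for independence: \<open>l\<close> will be the product of the
  barycentric coordinates of the two endpoints.\<close>

lemma edge_poly_eq_0_if_bubble_weighted:
  assumes "a \<noteq> b" "p \<in> poly_space m (closed_segment a b)"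
    and l: "\<And>t. t \<in> {0..1} \<Longrightarrow> l (linepath a b t) = t * (1 - t)"
    and int: "edge_integral (closed_segment a b) (\<lambda>x. l x * p x * p x) = 0"
  shows "p = 0"
proof -
  obtain P where p: "p = (\<lambda>x. if x \<in> closed_segment a b then poly P (edge_param a b x) else 0)"
    using assms(2) unfolding poly_space_segment_iff[OF assms(1)] by blast
  have "integral {0..1} (\<lambda>t. t * (1 - t) * (poly P t)\<^sup>2)
      = integral {0..1} (\<lambda>t. l (linepath a b t) * p (linepath a b t) * p (linepath a b t))"
    using l assms(1) by (intro integral_cong) (simp add: p power2_eq_square)
  then have "integral {0..1} (\<lambda>t. t * (1 - t) * (poly P t)\<^sup>2) = 0"
    using int assms(1) by (simp add: edge_integral_closed_segment)
  then have "P = 0" by (rule poly_eq_0_if_weighted_square_integral_0)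
  then show ?thesis by (auto simp: p zero_fun_def)
qed

text \<open>The form needed for the kernel: t (1 - t) splits off, and the cofactor, of degree two
  less, is itself an admissible weight; the moment against it integrates a weighted square.\<close>

lemma edge_poly_eq_0_if_moments_0:
  assumes "a \<noteq> b" "g \<in> poly_space m (closed_segment a b)" "g a = 0" "g b = 0"
    and int: "\<And>p. p \<in> poly_space (m - 2) (closed_segment a b) \<Longrightarrow>
       edge_integral (closed_segment a b) (\<lambda>x. g x * p x) = 0"
  shows "g = 0"
proof -
  let ?e = "closed_segment a b"
  obtain G where G: "deg_le m G" and g: "g = (\<lambda>x. if x \<in> ?e then poly G (edge_param a b x) else 0)"
    using assms(2) unfolding poly_space_segment_iff[OF assms(1)] by blast
  have "poly G 0 = 0" "poly G 1 = 0"
    using assms(1,3,4) edge_param_linepath[of a b 0] edge_param_linepath[of a b 1]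
    by (simp_all add: g linepath_def)
  then obtain H0 where H0: "G = [:0, 1:] * H0" using poly_eq_0_iff_dvd[of G 0] by (auto elim: dvdE)
  with \<open>poly G 1 = 0\<close> have "poly H0 1 = 0" by simp
  then obtain H1 where H1: "H0 = [:-1, 1:] * H1" using poly_eq_0_iff_dvd[of H0 1] by (auto elim: dvdE)
  \<comment> \<open>The root 1 gives the factor t - 1; the sign is moved into \<open>H\<close> to
    obtain the weight t (1 - t), which is nonnegative on [0, 1].\<close>
  define H where "H = - H1"
  have GH: "G = [:0, 1:] * ([:1, -1:] * H)" by (simp add: H0 H1 H_def)
  define h where "h = (\<lambda>x. if x \<in> ?e then poly H (edge_param a b x) else 0)"
  have "degree G = degree H + 2" if "H \<noteq> 0"
  proof -
    have nz: "[:1, -1:] * H \<noteq> 0" using that by (simp only: mult_eq_0_iff) simp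
    have "degree ([:1, -1:] * H) = 1 + degree H"
      using that by (subst degree_mult_eq) auto
    then show ?thesis unfolding GH by (subst degree_mult_eq[OF _ nz]) auto
  qed
  moreover have "G \<noteq> 0" if "H \<noteq> 0"
    using that unfolding GH by (simp only: mult_eq_0_iff) simp
  ultimately have "deg_le (m - 2) H"
    using G unfolding deg_le_def by force
  then have "h \<in> poly_space (m - 2) ?e"
    unfolding poly_space_segment_iff[OF assms(1)] h_def by blast
  then have "edge_integral ?e (\<lambda>x. g x * h x) = 0" by (rule int)
  moreover have "integral {0..1} (\<lambda>t. g (linepath a b t) * h (linepath a b t))
      = integral {0..1} (\<lambda>t. t * (1 - t) * (poly H t)\<^sup>2)"
    using assms(1) by (intro integral_cong) (simp add: g h_def GH power2_eq_square algebra_simps)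
  ultimately have "H = 0"
    using assms(1) by (intro poly_eq_0_if_weighted_square_integral_0) (simp add: edge_integral_closed_segment)
  then show ?thesis by (auto simp: g GH zero_fun_def)
qed

section \<open>Triangles and integration\<close>

text \<open>The vertices carry an order, so a fact about one vertex or edge passes to the others by
  rotation and swap.\<close>

definition is_triangle :: "plane \<Rightarrow> plane \<Rightarrow> plane \<Rightarrow> plane set \<Rightarrow> bool" where
  "is_triangle a b c f \<longleftrightarrow> f = convex hull {a, b, c} \<and> \<not> collinear {a, b, c}"

lemma simplex_imp_triangle:
  assumes "2 simplex (f :: plane set)"
  obtains a b c where "is_triangle a b c f"
proof -
  obtain C where C: "\<not> affine_dependent C" "card C = 3" "f = convex hull C"
    using assms by (auto simp: simplex_def)
  then obtain a b c where "C = {a, b, c}" "a \<noteq> b" "b \<noteq> c" "a \<noteq> c" by (metis card_3_iff)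
  then show thesis
    using C that[of a b c] by (auto simp: is_triangle_def collinear_3_eq_affine_dependent)
qed

lemma triangle_rotate: "is_triangle a b c f \<Longrightarrow> is_triangle b c a f"
  by (simp add: is_triangle_def insert_commute)

lemma triangle_swap: "is_triangle a b c f \<Longrightarrow> is_triangle b a c f"
  by (simp add: is_triangle_def insert_commute)

lemma triangle_distinct: "is_triangle a b c f \<Longrightarrow> a \<noteq> b \<and> b \<noteq> c \<and> a \<noteq> c"
  by (auto simp: is_triangle_def collinear_3_eq_affine_dependent)

lemma triangle_independent: "is_triangle a b c f \<Longrightarrow> \<not> affine_dependent {a, b, c}"
  by (auto simp: is_triangle_def collinear_3_eq_affine_dependent)

lemma triangle_verts_of: "is_triangle a b c f \<Longrightarrow> verts_of f = {a, b, c}"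
  using triangle_independent[of a b c f] extreme_point_of_convex_hull_affine_independent[of "{a, b, c}"]
  unfolding verts_of_def is_triangle_def by blast

text \<open>The faces of a simplex are the hulls of subsets of its vertices; dimension 1 singles out
  the two-element subsets.\<close>

lemma triangle_edges_of:
  assumes "is_triangle a b c f"
  shows "edges_of f = {closed_segment a b, closed_segment b c, closed_segment a c}"
proof -
  let ?C = "{a, b, c}"
  have ind: "\<not> affine_dependent ?C" by (rule triangle_independent[OF assms])
  have f: "f = convex hull ?C" using assms by (simp add: is_triangle_def)
  note d = triangle_distinct[OF assms]
  have "aff_dim (convex hull T) = 1 \<longleftrightarrow> card T = 2" if "T \<subseteq> ?C" for T
    using aff_dim_affine_independent[OF affine_independent_subset[OF ind that]]
    by (auto simp: aff_dim_convex_hull)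
  then have "edges_of f = (\<lambda>T. convex hull T) ` {T. T \<subseteq> ?C \<and> card T = 2}"
    unfolding edges_of_def edge_of_def f face_of_convex_hull_affine_independent[OF ind] by auto
  also have "{T. T \<subseteq> ?C \<and> card T = 2} = {{a, b}, {b, c}, {a, c}}"
    using d by (auto simp: card_2_iff)
  finally show ?thesis by (auto simp: segment_convex_hull)
qed

lemma triangle_card:
  assumes "is_triangle a b c f"
  shows "card (verts_of f) = 3" "card (edges_of f) = 3"
  using triangle_distinct[OF assms]
  by (auto simp: triangle_verts_of[OF assms] triangle_edges_of[OF assms] closed_segment_eq doubleton_eq_iff)

lemma triangle_at_vert:
  assumes "is_triangle a b c f" "x \<in> verts_of f"
  obtains y z where "is_triangle x y z f"
proof -
  have "is_triangle b c a f" "is_triangle c a b f" using assms(1) triangle_rotate by blast+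
  then show thesis using assms that triangle_verts_of[OF assms(1)] by auto
qed

lemma triangle_at_edge:
  assumes "is_triangle a b c f" "e \<in> edges_of f"
  obtains x y z where "is_triangle x y z f" "e = closed_segment x y"
proof -
  have "is_triangle b c a f" "is_triangle a c b f" using assms(1) triangle_rotate triangle_swap by blast+
  then show thesis using assms that triangle_edges_of[OF assms(1)] by auto
qed

lemma edge_subset: "e \<in> edges_of f \<Longrightarrow> e \<subseteq> f"
  by (simp add: edges_of_def edge_of_imp_subset)

lemma triangle_compact: "is_triangle a b c f \<Longrightarrow> compact f"
  by (auto simp: is_triangle_def intro!: finite_imp_compact_convex_hull)

lemma triangle_convex: "is_triangle a b c f \<Longrightarrow> convex f"
  by (simp add: is_triangle_def)

lemma triangle_interior:
  assumes "is_triangle a b c f"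
  shows "interior f \<noteq> {}"
proof -
  \<comment> \<open>The centroid is an interior point.\<close>
  have "(1/3) *\<^sub>R a + (1/3) *\<^sub>R b + (1/3) *\<^sub>R c \<in> interior f"
    using assms unfolding is_triangle_def
    by (auto simp: interior_convex_hull_3_minimal intro!: exI[of _ "1/3 :: real"])
  then show ?thesis by blast
qed

section \<open>Barycentric coordinates\<close>

definition cross2 :: "plane \<Rightarrow> plane \<Rightarrow> real" where
  "cross2 u v = u $ 1 * v $ 2 - u $ 2 * v $ 1"

text \<open>The barycentric coordinate belonging to \<open>a\<close>, as the ratio of the signed
  areas of the triangles \<open>x b c\<close> and \<open>a b c\<close>; \<open>cross2\<close> is a
  determinant, hence twice a signed area.\<close>

definition bary :: "plane \<Rightarrow> plane \<Rightarrow> plane \<Rightarrow> plane \<Rightarrow> real" where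
  "bary a b c x = cross2 (b - x) (c - x) / cross2 (b - a) (c - a)"

lemma cross2_nonzero:
  assumes "is_triangle a b c f"
  shows "cross2 (b - a) (c - a) \<noteq> 0"
proof
  assume z: "cross2 (b - a) (c - a) = 0"
  define u v where "u = b - a" and "v = c - a"
  have "\<exists>r. v = r *\<^sub>R u" if "u \<noteq> 0"
  proof (cases "u $ 1 = 0")
    case True
    then have "u $ 2 \<noteq> 0" using that by (auto simp: vec_eq_iff forall_2)
    then show ?thesis
      using z True by (intro exI[of _ "v $ 2 / u $ 2"])
        (auto simp: vec_eq_iff forall_2 cross2_def field_simps simp flip: u_def v_def)
  next
    case False
    then show ?thesis
      using z by (intro exI[of _ "v $ 1 / u $ 1"])
        (auto simp: vec_eq_iff forall_2 cross2_def field_simps simp flip: u_def v_def)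
  qed
  then have "collinear {0, b - a, c - a}" unfolding collinear_lemma u_def v_def by auto
  then have "collinear {b, a, c}" using collinear_3[of b a c] by simp
  then show False using assms by (simp add: is_triangle_def insert_commute)
qed

lemma affine_fun_bary: "affine_fun (bary a b c)"
proof -
  define D where "D = cross2 (b - a) (c - a)"
  have "bary a b c x = cross2 b c / D + ((b $ 2 - c $ 2) / D) * x $ 1 + ((c $ 1 - b $ 1) / D) * x $ 2" for x
    by (simp add: bary_def add_divide_distrib[symmetric] flip: D_def) (simp add: cross2_def algebra_simps)
  then show ?thesis unfolding affine_fun_def by blast
qed

lemma affine_fun_linepath:
  "affine_fun l \<Longrightarrow> l (linepath p q t) = (1 - t) * l p + t * l q"
  by (auto simp: affine_fun_def linepath_def algebra_simps)

lemma bary_vertex: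
  assumes "is_triangle a b c f"
  shows "bary a b c a = 1" "bary a b c b = 0" "bary a b c c = 0"
  using cross2_nonzero[OF assms] by (simp_all add: bary_def) (simp_all add: cross2_def)

lemma bary_linepath:
  assumes "is_triangle a b c f"
  shows "bary a b c (linepath a b t) = 1 - t" "bary b a c (linepath a b t) = t"
    "bary a b c (linepath b c t) = 0" "bary b a c (linepath a c t) = 0"
  using bary_vertex[OF assms] bary_vertex[OF triangle_swap[OF assms]]
  by (simp_all add: affine_fun_linepath[OF affine_fun_bary])

section \<open>Unit tangents and normals of a segment\<close>

lemma linepath_diff: "linepath a b q - linepath a b p = (q - p) *\<^sub>R (b - a)"
  by (simp add: linepath_def algebra_simps)

definition rot :: "plane \<Rightarrow> plane" where
  "rot u = vector [- u $ 2, u $ 1]"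

lemma unit_tangent_segment:
  assumes "a \<noteq> b" "unit_tangent (closed_segment a b) t"
  shows "t = sgn (b - a) \<or> t = - sgn (b - a)"
proof -
  obtain x y c where xy: "norm t = 1" "x \<in> closed_segment a b" "y \<in> closed_segment a b" "t = c *\<^sub>R (y - x)"
    using assms(2) by (auto simp: unit_tangent_def)
  obtain p q where "x = linepath a b p" "y = linepath a b q"
    using xy by (metis closed_segmentE_linepath)
  then have "y - x = (q - p) *\<^sub>R (b - a)" by (simp add: linepath_diff)
  then have t: "t = (c * (q - p)) *\<^sub>R (b - a)" using xy by simp
  define r where "r = c * (q - p)"
  have "\<bar>r\<bar> * norm (b - a) = 1" using t xy(1) by (simp add: r_def)
  then have "\<bar>r\<bar> = 1 / norm (b - a)" using assms(1) by (simp add: field_simps)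
  then have "r = inverse (norm (b - a)) \<or> r = - inverse (norm (b - a))"
    by (auto simp: abs_if divide_inverse split: if_splits)
  then show ?thesis using t unfolding r_def[symmetric] sgn_div_norm by auto
qed

lemma unit_tangent_unique:
  assumes "a \<noteq> b" "unit_tangent (closed_segment a b) t" "unit_tangent (closed_segment a b) u"
  shows "t = u \<or> t = - u"
  using unit_tangent_segment[OF assms(1,2)] unit_tangent_segment[OF assms(1,3)] by auto

text \<open>In the plane, the vectors orthogonal to \<open>d\<close> form the line through its
  quarter turn \<open>rot d\<close>; unit length leaves two opposite multiples.\<close>

lemma unit_normal_unique:
  assumes "a \<noteq> b" "unit_normal (closed_segment a b) n" "unit_normal (closed_segment a b) m"
  shows "n = m \<or> n = - m"
proof -
  define d where "d = b - a"
  have d0: "d \<noteq> 0" using assms(1) by (simp add: d_def)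
  have dd: "d $ 1 * d $ 1 + d $ 2 * d $ 2 > 0"
    using d0 sum_squares_gt_zero_iff[of "d $ 1" "d $ 2"] by (auto simp: vec_eq_iff forall_2)
  have *: "\<exists>s. n = s *\<^sub>R rot d \<and> \<bar>s\<bar> * norm (rot d) = 1" if "unit_normal (closed_segment a b) n" for n
  proof -
    have nd: "n $ 1 * d $ 1 + n $ 2 * d $ 2 = 0" and n1: "norm n = 1"
      using that by (auto simp: unit_normal_def d_def inner_vec_def sum_2)
    \<comment> \<open>The coefficient of the projection of \<open>n\<close> onto
      \<open>rot d\<close>, whose squared length is that of \<open>d\<close>.\<close>
    define s where "s = (n $ 2 * d $ 1 - n $ 1 * d $ 2) / (d $ 1 * d $ 1 + d $ 2 * d $ 2)"
    let ?D = "d $ 1 * d $ 1 + d $ 2 * d $ 2" and ?N = "n $ 2 * d $ 1 - n $ 1 * d $ 2"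
    have "n $ 1 * ?D = ?N * (- d $ 2)" "n $ 2 * ?D = ?N * d $ 1"
      using nd by algebra+
    then have "n $ 1 = ?N * (- d $ 2) / ?D" "n $ 2 = ?N * d $ 1 / ?D"
      using dd by (simp_all only: nonzero_eq_divide_eq[OF less_imp_neq[OF dd, symmetric]])
    then have "n $ 1 = s * (- d $ 2)" "n $ 2 = s * d $ 1"
      by (simp_all only: s_def times_divide_eq_left)
    then have "n = s *\<^sub>R rot d"
      by (simp add: vec_eq_iff forall_2 rot_def)
    then show ?thesis using n1 by auto
  qed
  obtain s s' where s: "n = s *\<^sub>R rot d" "\<bar>s\<bar> * norm (rot d) = 1" "m = s' *\<^sub>R rot d" "\<bar>s'\<bar> * norm (rot d) = 1"
    using *[OF assms(2)] *[OF assms(3)] by blast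
  have "norm (rot d) \<noteq> 0" using s(2) by auto
  then have "\<bar>s\<bar> = \<bar>s'\<bar>" using s(2,4) by (metis mult_right_cancel)
  then show ?thesis using s(1,3) by (auto simp: abs_eq_iff)
qed

lemma unit_tangent_exists:
  assumes "a \<noteq> b"
  shows "\<exists>t. unit_tangent (closed_segment a b) t"
proof -
  have "unit_tangent (closed_segment a b) (sgn (b - a))"
    unfolding unit_tangent_def
  proof
    show "norm (sgn (b - a)) = 1" using assms by (simp add: norm_sgn)
    have "sgn (b - a) = inverse (norm (b - a)) *\<^sub>R (b - a)" by (simp add: sgn_div_norm)
    then show "\<exists>x\<in>closed_segment a b. \<exists>y\<in>closed_segment a b. \<exists>c. sgn (b - a) = c *\<^sub>R (y - x)"
      by (intro bexI[of _ a] bexI[of _ b] exI) auto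
  qed
  then show ?thesis by blast
qed

lemma unit_normal_exists:
  assumes "a \<noteq> b"
  shows "\<exists>n. unit_normal (closed_segment a b) n"
proof -
  define d where "d = b - a"
  have "rot d \<noteq> 0" using assms by (auto simp: rot_def d_def vec_eq_iff forall_2)
  have "sgn (rot d) \<bullet> (y - x) = 0" if xy: "x \<in> closed_segment a b" "y \<in> closed_segment a b" for x y
  proof -
    obtain p q where "x = linepath a b p" "y = linepath a b q"
      using xy by (metis closed_segmentE_linepath)
    then have "y - x = (q - p) *\<^sub>R d" by (simp add: linepath_diff d_def)
    moreover have "rot d \<bullet> d = 0" by (simp add: rot_def inner_vec_def sum_2)
    ultimately show ?thesis by (simp add: sgn_div_norm)
  qed
  then show ?thesis using \<open>rot d \<noteq> 0\<close> unfolding unit_normal_def by (intro exI[of _ "sgn (rot d)"]) (simp add: norm_sgn)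
qed

lemma tangent_normal_orthogonal: "unit_tangent e t \<Longrightarrow> unit_normal e n \<Longrightarrow> n \<bullet> t = 0"
  unfolding unit_tangent_def unit_normal_def by auto

section \<open>Integrals over edges and triangles\<close>

lemma edge_integral_cong:
  "(\<And>x. x \<in> closed_segment a b \<Longrightarrow> g x = h x) \<Longrightarrow>
    edge_integral (closed_segment a b) g = edge_integral (closed_segment a b) h"
  unfolding edge_integral_closed_segment by (intro arg_cong[where f = "\<lambda>y. dist a b * y"] integral_cong) simp

lemma edge_integral_linear:
  assumes "continuous_on (closed_segment a b) g" "continuous_on (closed_segment a b) h"
  shows "edge_integral (closed_segment a b) (\<lambda>x. r * g x + s * h x)
    = r * edge_integral (closed_segment a b) g + s * edge_integral (closed_segment a b) h"
proof -
  have "(\<lambda>t. g (linepath a b t)) integrable_on {0..1}" if "continuous_on (closed_segment a b) g" for g :: "plane \<Rightarrow> real"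
  proof (rule integrable_continuous_interval)
    have "continuous_on {0..1} (linepath a b)" by (rule continuous_on_linepath)
    then show "continuous_on {0..1} (\<lambda>t. g (linepath a b t))"
      by (rule continuous_on_compose2[OF that]) auto
  qed
  then have "integral {0..1} (\<lambda>t. r * g (linepath a b t) + s * h (linepath a b t))
     = r * integral {0..1} (\<lambda>t. g (linepath a b t)) + s * integral {0..1} (\<lambda>t. h (linepath a b t))"
    using assms by (subst integral_add) (auto intro!: integrable_on_mult_right)
  then show ?thesis by (simp add: edge_integral_closed_segment algebra_simps)
qed

lemma edge_integral_zero: "edge_integral (closed_segment a b) (\<lambda>x. 0) = 0"
  by (simp add: edge_integral_closed_segment)

lemma integrable_continuous_compact:
  fixes g :: "plane \<Rightarrow> real"
  assumes "compact f" "continuous_on f g"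
  shows "g integrable_on f"
  using borel_integrable_compact[OF assms] set_borel_integral_eq_integral(1)[of f g]
  by (simp add: set_integrable_def)

text \<open>An interior point lies in a box inside \<open>f\<close>, whose integral is squeezed
  between 0 and the integral over \<open>f\<close>. Boundary points follow by continuity, because
  \<open>f\<close> is the closure of its interior.\<close>

lemma continuous_nonneg_integral_eq_0:
  fixes g :: "plane \<Rightarrow> real"
  assumes "compact f" "convex f" "interior f \<noteq> {}" "continuous_on f g"
    and "\<And>x. x \<in> f \<Longrightarrow> g x \<ge> 0" and "integral f g = 0" and "x \<in> f"
  shows "g x = 0"
proof -
  have int: "g y = 0" if y: "y \<in> interior f" for y
  proof -
    obtain a b where ab: "y \<in> box a b" "cbox a b \<subseteq> interior f"
      using open_contains_cbox[of "interior f"] y by (metis open_interior)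
    then have sub: "cbox a b \<subseteq> f" using interior_subset by blast
    then have cont: "continuous_on (cbox a b) g" using assms(4) continuous_on_subset by blast
    have "integral (cbox a b) g \<le> integral f g"
      using sub integrable_continuous[OF cont] integrable_continuous_compact[OF assms(1,4)] assms(5)
      by (intro integral_subset_le) auto
    moreover have "integral (cbox a b) g \<ge> 0"
      using integrable_continuous[OF cont] sub assms(5) by (intro integral_nonneg) auto
    ultimately have "integral (cbox a b) g = 0" using assms(6) by simp
    moreover have "box a b \<noteq> {}" using ab by blast
    ultimately show ?thesis
      using integral_cbox_eq_0_iff[OF cont] sub assms(5) ab(1) box_subset_cbox[of a b] by blast
  qed
  have "closure (interior f) = f"
    using convex_closure_interior[OF assms(2,3)] assms(1) by (simp add: compact_imp_closed)
  then show ?thesis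
    using continuous_constant_on_closure[of "interior f" g 0 x] assms(4,7) int by simp
qed

section \<open>Degrees of freedom on a triangle\<close>

lemma quadratic_form_eq:
  "u \<bullet> (A *v u) = u $ 1 * u $ 1 * A $ 1 $ 1 + u $ 1 * u $ 2 * A $ 1 $ 2
     + u $ 2 * u $ 1 * A $ 2 $ 1 + u $ 2 * u $ 2 * (A :: mat2) $ 2 $ 2"
  by (simp add: inner_vec_def matrix_vector_mult_def sum_2 algebra_simps)

lemma quadratic_form_neg: "(- u) \<bullet> (A *v (- u)) = u \<bullet> ((A :: mat2) *v u)"
  by (simp add: quadratic_form_eq)

lemma frob_eq: "frob A B = A $ 1 $ 1 * B $ 1 $ 1 + A $ 1 $ 2 * B $ 1 $ 2 + A $ 2 $ 1 * B $ 2 $ 1 + A $ 2 $ 2 * B $ 2 $ 2"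
  by (simp add: frob_def sum_2)

lemma frob_commute: "frob A B = frob B A"
  by (simp add: frob_eq mult.commute)

lemma frob_linear: "linear_form_on V (frob A)"
  by (simp add: linear_form_on_def frob_eq algebra_simps)

lemma frob_zero [simp]: "frob 0 A = 0" "frob A 0 = 0"
  by (simp_all add: frob_eq)

lemma frob_self_nonneg: "frob A A \<ge> 0"
  by (simp add: frob_eq)

lemma frob_self_eq_0: "frob A A = 0 \<Longrightarrow> A = 0"
proof -
  assume "frob A A = 0"
  moreover have "A $ i $ j * A $ i $ j \<ge> 0" for i j by simp
  ultimately have "A $ 1 $ 1 * A $ 1 $ 1 = 0 \<and> A $ 1 $ 2 * A $ 1 $ 2 = 0 \<and> A $ 2 $ 1 * A $ 2 $ 1 = 0 \<and> A $ 2 $ 2 * A $ 2 $ 2 = 0"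
    unfolding frob_eq by (smt (verit))
  then show "A = 0" by (simp add: vec_eq_iff forall_2)
qed

lemma sym_mats_iff: "A \<in> sym_mats \<longleftrightarrow> A $ 1 $ 2 = A $ 2 $ 1"
  by (auto simp: sym_mats_def transpose_def vec_eq_iff forall_2)

lemma subspace_sym_mats [intro, simp]: "subspace sym_mats"
  by (auto simp: subspace_def sym_mats_iff)

definition outer :: "plane \<Rightarrow> mat2" where
  "outer t = (\<chi> i j. t $ i * t $ j)"

lemma outer_sym [simp]: "outer t \<in> sym_mats"
  by (simp add: outer_def sym_mats_iff)

text \<open>Hence \<open>outer\<close> of a unit tangent has tangential component 1 and normal
  component 0, and conversely for a unit normal: this separates the two kinds of edge
  moments.\<close>

lemma quadratic_form_outer: "u \<bullet> (outer t *v u) = (u \<bullet> t)\<^sup>2"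
  unfolding quadratic_form_eq outer_def vec_lambda_beta
  by (simp add: inner_vec_def sum_2 power2_eq_square algebra_simps)

lemma dim_sym_mats: "dim sym_mats = 3"
proof -
  define L :: "nat \<Rightarrow> mat2 \<Rightarrow> real" where
    "L i A = (if i = 0 then A $ 1 $ 1 else if i = 1 then A $ 1 $ 2 else A $ 2 $ 2)" for i A
  define w :: "nat \<Rightarrow> mat2" where
    "w i = (\<chi> r s. if i = 0 then of_bool (r = 1 \<and> s = 1) else
       if i = 1 then of_bool (r \<noteq> s) else of_bool (r = 2 \<and> s = 2))" for i
  have "dim sym_mats = card {0, 1, 2 :: nat}"
  proof (rule dim_eq_card_forms[where L = L and w = w])
    show "A = 0" if "A \<in> sym_mats" "\<And>i. i \<in> {0, 1, 2} \<Longrightarrow> L i A = 0" for A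
      using that(1) that(2)[of 0] that(2)[of 1] that(2)[of 2]
      by (auto simp: L_def sym_mats_iff vec_eq_iff forall_2)
  qed (auto simp: linear_form_on_def L_def w_def sym_mats_iff)
  then show ?thesis by simp
qed

section \<open>Symmetric matrix fields with polynomial entries\<close>

definition tensor :: "(plane \<Rightarrow> real) \<Rightarrow> mat2 \<Rightarrow> tensor_field" where
  "tensor p M = (\<lambda>x. p x *\<^sub>R M)"

lemma tensor_mem:
  assumes "p \<in> poly_space (int k) f" "M \<in> sym_mats"
  shows "tensor p M \<in> sym_poly_space k f"
proof -
  have "(\<lambda>x. p x * c) \<in> poly_space (int k) f" for c
    using scale_mem_poly_space[OF assms(1), of c] by (simp add: mult.commute)
  then show ?thesis
    using assms(2) by (auto simp: sym_poly_space_def tensor_def sym_mats_iff)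
qed

lemma sym_poly_space_entry: "\<sigma> \<in> sym_poly_space k f \<Longrightarrow> (\<lambda>x. \<sigma> x $ i $ j) \<in> poly_space (int k) f"
  by (simp add: sym_poly_space_def)

lemma sym_poly_space_sym: "\<sigma> \<in> sym_poly_space k f \<Longrightarrow> \<sigma> x \<in> sym_mats"
  by (simp add: sym_poly_space_def)

lemma subspace_sym_poly_space [intro, simp]: "subspace (sym_poly_space k f)"
  unfolding subspace_def sym_poly_space_def
  by (auto simp: zero_fun_def[symmetric] sym_mats_iff subspace_0 add_mem_poly_space scale_mem_poly_space)

lemma sym_poly_space_outside: "\<sigma> \<in> sym_poly_space k f \<Longrightarrow> x \<notin> f \<Longrightarrow> \<sigma> x = 0"
  using poly_space_outside[OF sym_poly_space_entry] by (auto simp: vec_eq_iff)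

lemma sym_poly_space_continuous: "\<sigma> \<in> sym_poly_space k f \<Longrightarrow> continuous_on f (\<lambda>x. \<sigma> x $ i $ j)"
  using poly_space_continuous sym_poly_space_entry by blast

lemma quadratic_form_continuous:
  assumes "\<sigma> \<in> sym_poly_space k f" "e \<subseteq> f"
  shows "continuous_on e (\<lambda>x. u \<bullet> (\<sigma> x *v u))"
proof -
  have "continuous_on e (\<lambda>x. \<sigma> x $ i $ j)" for i j
    using sym_poly_space_continuous[OF assms(1)] assms(2) by (rule continuous_on_subset)
  then show ?thesis
    unfolding quadratic_form_eq by (intro continuous_on_add continuous_on_mult continuous_on_const)
qed

lemma frob_continuous:
  "\<sigma> \<in> sym_poly_space k f \<Longrightarrow> b \<in> sym_poly_space k f \<Longrightarrow> continuous_on f (\<lambda>x. frob (\<sigma> x) (b x))"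
  unfolding frob_eq by (intro continuous_on_add continuous_on_mult sym_poly_space_continuous)

lemma quadratic_form_mem_poly_space:
  assumes "\<sigma> \<in> sym_poly_space k f" "e \<subseteq> f"
  shows "(\<lambda>x. if x \<in> e then u \<bullet> (\<sigma> x *v u) else 0) \<in> poly_space (int k) e"
  unfolding quadratic_form_eq
  by (rule poly_space_restrict[OF assms(2)])
    (intro add_mem_poly_space scale_mem_poly_space sym_poly_space_entry[OF assms(1)])

text \<open>Products of a basis of the scalar polynomials with a basis of the symmetric matrices
  form a basis of the tensor product.\<close>

lemma sym_poly_space_dim:
  assumes "interior f \<noteq> {}"
  shows "2 * dim (sym_poly_space k f) = 3 * ((k + 1) * (k + 2))"
    and "\<exists>T. finite T \<and> sym_poly_space k f = span T"
proof -
  obtain P where P: "finite P" "independent P" "span P = poly_space (int k) f"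
    using dim_poly_space_interior(2)[OF assms] unfolding is_basis_of_def by blast
  obtain S where S: "S \<subseteq> sym_mats" "independent S" "sym_mats \<subseteq> span S" "card S = dim sym_mats"
    using basis_exists[of sym_mats] by blast
  have fS: "finite S" using S(2) by (rule independent_imp_finite)
  let ?v = "\<lambda>(p, M). tensor p M"
  have fin: "finite (P \<times> S)" using P(1) fS by simp
  have ind: "\<forall>u\<in>P \<times> S. c u = 0" if c: "(\<Sum>u\<in>P \<times> S. c u *\<^sub>R ?v u) = 0" for c
  proof -
    \<comment> \<open>At a fixed point the relation is one among matrices, so independence of
      \<open>S\<close> isolates each \<open>M\<close>; letting \<open>x\<close> vary then gives a
      relation within \<open>P\<close>.\<close>
    have "(\<Sum>p\<in>P. c (p, M) * p x) = 0" if M: "M \<in> S" for x M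
    proof -
      have "(\<Sum>u\<in>P \<times> S. c u *\<^sub>R ?v u) x = (\<Sum>(p, M)\<in>P \<times> S. (c (p, M) * p x) *\<^sub>R M)"
        by (simp add: sum_fun_apply case_prod_beta tensor_def)
      also have "\<dots> = (\<Sum>p\<in>P. \<Sum>M\<in>S. (c (p, M) * p x) *\<^sub>R M)"
        by (rule sum.cartesian_product[symmetric])
      also have "\<dots> = (\<Sum>M\<in>S. \<Sum>p\<in>P. (c (p, M) * p x) *\<^sub>R M)"
        by (rule sum.swap)
      also have "\<dots> = (\<Sum>M\<in>S. (\<Sum>p\<in>P. c (p, M) * p x) *\<^sub>R M)"
        by (simp add: scaleR_sum_left)
      finally have "(\<Sum>M\<in>S. (\<Sum>p\<in>P. c (p, M) * p x) *\<^sub>R M) = (\<Sum>u\<in>P \<times> S. c u *\<^sub>R ?v u) x" ..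
      then have "(\<Sum>M\<in>S. (\<Sum>p\<in>P. c (p, M) * p x) *\<^sub>R M) = 0" using c by simp
      then show ?thesis
        using independentD[OF S(2) fS order_refl _ M, of "\<lambda>M. \<Sum>p\<in>P. c (p, M) * p x"] by blast
    qed
    then have "(\<Sum>p\<in>P. c (p, M) *\<^sub>R p) = 0" if "M \<in> S" for M
      using that by (auto simp: fun_eq_iff sum_fun_apply)
    then have "c (p, M) = 0" if "M \<in> S" "p \<in> P" for p M
      using independentD[OF P(2,1) order_refl, of "\<lambda>p. c (p, M)"] that by blast
    then show ?thesis by auto
  qed
  have "tensor p M \<in> span (?v ` (P \<times> S))" if p: "p \<in> poly_space (int k) f" and M: "M \<in> sym_mats" for p M
  proof -
    obtain r where r: "p = (\<Sum>q\<in>P. r q *\<^sub>R q)"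
      using p P(3) span_finite[OF P(1)] by auto
    obtain s where s: "M = (\<Sum>N\<in>S. s N *\<^sub>R N)"
      using M S(3) span_finite[OF fS] by auto
    have "tensor p M x = (\<Sum>q\<in>P. \<Sum>N\<in>S. (r q * s N) *\<^sub>R tensor q N) x" for x
    proof -
      have "p x *\<^sub>R M = (\<Sum>q\<in>P. (r q * q x) *\<^sub>R M)"
        by (simp add: r sum_fun_apply scaleR_sum_left)
      also have "\<dots> = (\<Sum>q\<in>P. \<Sum>N\<in>S. (r q * q x * s N) *\<^sub>R N)"
        by (simp add: s scaleR_sum_right)
      finally show ?thesis by (simp add: tensor_def sum_fun_apply mult_ac)
    qed
    then have "tensor p M = (\<Sum>q\<in>P. \<Sum>N\<in>S. (r q * s N) *\<^sub>R tensor q N)" by blast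
    also have "\<dots> \<in> span (?v ` (P \<times> S))"
      by (rule span_sum, rule span_sum, rule span_scale, rule span_base) auto
    finally show ?thesis .
  qed
  note mem = this
  have sp: "sym_poly_space k f = span (?v ` (P \<times> S))"
  proof
    have "?v ` (P \<times> S) \<subseteq> sym_poly_space k f"
      using P(3) S(1) span_superset[of P] by (auto intro!: tensor_mem)
    then show "span (?v ` (P \<times> S)) \<subseteq> sym_poly_space k f" by (rule span_minimal) simp
    show "sym_poly_space k f \<subseteq> span (?v ` (P \<times> S))"
    proof
      fix \<sigma> assume \<sigma>: "\<sigma> \<in> sym_poly_space k f"
      define E1 E2 E3 :: mat2 where "E1 = (\<chi> i j. of_bool (i = 1 \<and> j = 1))"
        and "E2 = (\<chi> i j. of_bool (i \<noteq> j))" and "E3 = (\<chi> i j. of_bool (i = 2 \<and> j = 2))"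
      have "\<sigma> = tensor (\<lambda>x. \<sigma> x $ 1 $ 1) E1 + (tensor (\<lambda>x. \<sigma> x $ 1 $ 2) E2 + tensor (\<lambda>x. \<sigma> x $ 2 $ 2) E3)"
        using sym_poly_space_sym[OF \<sigma>]
        by (auto simp: fun_eq_iff vec_eq_iff forall_2 tensor_def E1_def E2_def E3_def sym_mats_iff)
      also have "\<dots> \<in> span (?v ` (P \<times> S))"
        by (intro span_add mem sym_poly_space_entry[OF \<sigma>])
          (auto simp: sym_mats_iff E1_def E2_def E3_def)
      finally show "\<sigma> \<in> span (?v ` (P \<times> S))" .
    qed
  qed
  have "card P = dim (poly_space (int k) f)"
    using dim_span_eq_card_independent[OF P(2)] P(3) by simp
  then have "2 * card (P \<times> S) = 3 * ((k + 1) * (k + 2))"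
    using dim_poly_space_interior(1)[OF assms, of k] S(4) by (simp add: card_cartesian_product dim_sym_mats)
  then show "2 * dim (sym_poly_space k f) = 3 * ((k + 1) * (k + 2))"
    unfolding sp using dim_span_family[where v = ?v, OF fin ind] by simp
  show "\<exists>T. finite T \<and> sym_poly_space k f = span T"
    using sp fin by blast
qed

section \<open>Linearity of the degrees of freedom\<close>

lemma edge_moment_linear_field:
  assumes "closed_segment a b \<subseteq> f" "p \<in> poly_space m (closed_segment a b)"
  shows "linear_form_on (sym_poly_space k f) (edge_moment (closed_segment a b) u p)"
proof -
  let ?e = "closed_segment a b"
  have lin: "edge_moment ?e u p (r *\<^sub>R \<sigma> + s *\<^sub>R \<rho>) = r * edge_moment ?e u p \<sigma> + s * edge_moment ?e u p \<rho>"
    if "\<sigma> \<in> sym_poly_space k f" "\<rho> \<in> sym_poly_space k f" for r s \<sigma> \<rho>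
  proof -
    have "(\<lambda>x. (u \<bullet> ((r *\<^sub>R \<sigma> + s *\<^sub>R \<rho>) x *v u)) * p x)
        = (\<lambda>x. r * ((u \<bullet> (\<sigma> x *v u)) * p x) + s * ((u \<bullet> (\<rho> x *v u)) * p x))"
      by (auto simp: quadratic_form_eq algebra_simps)
    then show ?thesis
      unfolding edge_moment_def using assms that
      by (simp add: edge_integral_linear continuous_on_mult quadratic_form_continuous poly_space_continuous)
  qed
  show ?thesis
    unfolding linear_form_on_def
  proof (intro conjI ballI allI)
    fix \<sigma> \<rho> assume "\<sigma> \<in> sym_poly_space k f" "\<rho> \<in> sym_poly_space k f"
    then show "edge_moment ?e u p (\<sigma> + \<rho>) = edge_moment ?e u p \<sigma> + edge_moment ?e u p \<rho>"
      using lin[of \<sigma> \<rho> 1 1] by simp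
  next
    fix c \<sigma> assume "\<sigma> \<in> sym_poly_space k f"
    then show "edge_moment ?e u p (c *\<^sub>R \<sigma>) = c * edge_moment ?e u p \<sigma>"
      using lin[of \<sigma> \<sigma> c 0] by simp
  qed
qed

text \<open>Linearity in the weight collects the coefficients on an edge into one polynomial, and
  extends identities from the basis \<open>Q e\<close> to all weights.\<close>

lemma edge_moment_linear_weight:
  assumes "closed_segment a b \<subseteq> f" "\<sigma> \<in> sym_poly_space k f"
  shows "linear_form_on (poly_space m (closed_segment a b)) (\<lambda>p. edge_moment (closed_segment a b) u p \<sigma>)"
proof -
  let ?e = "closed_segment a b"
  have lin: "edge_moment ?e u (r *\<^sub>R p + s *\<^sub>R q) \<sigma> = r * edge_moment ?e u p \<sigma> + s * edge_moment ?e u q \<sigma>"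
    if "p \<in> poly_space m ?e" "q \<in> poly_space m ?e" for r s p q
  proof -
    have "(\<lambda>x. (u \<bullet> (\<sigma> x *v u)) * (r *\<^sub>R p + s *\<^sub>R q) x)
        = (\<lambda>x. r * ((u \<bullet> (\<sigma> x *v u)) * p x) + s * ((u \<bullet> (\<sigma> x *v u)) * q x))"
      by (auto simp: algebra_simps)
    then show ?thesis
      unfolding edge_moment_def using assms that
      by (simp add: edge_integral_linear continuous_on_mult quadratic_form_continuous poly_space_continuous)
  qed
  show ?thesis
    unfolding linear_form_on_def
  proof (intro conjI ballI allI)
    fix p q assume "p \<in> poly_space m ?e" "q \<in> poly_space m ?e"
    then show "edge_moment ?e u (p + q) \<sigma> = edge_moment ?e u p \<sigma> + edge_moment ?e u q \<sigma>"
      using lin[of p q 1 1] by simp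
  next
    fix c p assume "p \<in> poly_space m ?e"
    then show "edge_moment ?e u (c *\<^sub>R p) \<sigma> = c * edge_moment ?e u p \<sigma>"
      using lin[of p p c 0] by simp
  qed
qed

lemma interior_moment_linear:
  assumes "compact f" "b \<in> sym_poly_space k f"
  shows "linear_form_on (sym_poly_space k f) (\<lambda>\<sigma>. integral f (\<lambda>x. frob (\<sigma> x) (b x)))"
proof -
  have int: "(\<lambda>x. frob (\<sigma> x) (b x)) integrable_on f" if "\<sigma> \<in> sym_poly_space k f" for \<sigma>
    using integrable_continuous_compact[OF assms(1) frob_continuous[OF that assms(2)]] .
  have "frob (\<sigma> x + \<rho> x) (b x) = frob (\<sigma> x) (b x) + frob (\<rho> x) (b x)"
    "frob (c *\<^sub>R \<sigma> x) (b x) = c * frob (\<sigma> x) (b x)" for \<sigma> \<rho> x c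
    by (simp_all add: frob_eq algebra_simps)
  then show ?thesis
    unfolding linear_form_on_def using int by (simp add: integral_add)
qed

lemma bubble_space_subset: "bubble_space k f \<subseteq> sym_poly_space k f"
  by (auto simp: bubble_space_def)

lemma edge_moment_eq_0:
  assumes "\<And>x. x \<in> closed_segment a b \<Longrightarrow> u \<bullet> (\<sigma> x *v u) = 0"
  shows "edge_moment (closed_segment a b) u p \<sigma> = 0"
  unfolding edge_moment_def using assms edge_integral_zero[of a b]
  by (subst edge_integral_cong[where h = "\<lambda>x. 0"]) auto

lemma edge_moment_neg: "edge_moment e (- u) p \<sigma> = edge_moment e u p \<sigma>"
  by (simp only: edge_moment_def quadratic_form_neg)

lemma edge_moment_zero_weight: "edge_moment (closed_segment a b) u 0 \<sigma> = 0"
  by (simp add: edge_moment_def edge_integral_zero)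

text \<open>Vertex and edge sets are free parameters, so the same sums and counts serve one triangle
  and the whole mesh.\<close>

definition dof_index_set ::
  "plane set \<Rightarrow> plane set set \<Rightarrow> mat2 set \<Rightarrow> (plane set \<Rightarrow> (plane \<Rightarrow> real) set) \<Rightarrow> tensor_field set \<Rightarrow> dof_index set" where
  "dof_index_set X E S Q B = (\<lambda>(x, M). At_vertex x M) ` (X \<times> S) \<union>
     (\<lambda>(e, p). Tangential e p) ` (SIGMA e:E. Q e) \<union> (\<lambda>(e, p). Normal e p) ` (SIGMA e:E. Q e) \<union> Interior ` B"

lemma finite_dof_index_set:
  "finite X \<Longrightarrow> finite E \<Longrightarrow> finite S \<Longrightarrow> (\<And>e. e \<in> E \<Longrightarrow> finite (Q e)) \<Longrightarrow> finite B \<Longrightarrow>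
    finite (dof_index_set X E S Q B)"
  unfolding dof_index_set_def
  by (intro finite_UnI finite_imageI finite_cartesian_product finite_SigmaI)

lemma sum_dof_index_set:
  fixes h :: "dof_index \<Rightarrow> 'b :: comm_monoid_add"
  assumes "finite X" "finite E" "finite S" "\<And>e. e \<in> E \<Longrightarrow> finite (Q e)" "finite B"
  shows "sum h (dof_index_set X E S Q B) = (\<Sum>x\<in>X. \<Sum>M\<in>S. h (At_vertex x M))
     + (\<Sum>e\<in>E. \<Sum>p\<in>Q e. h (Tangential e p))
     + (\<Sum>e\<in>E. \<Sum>p\<in>Q e. h (Normal e p)) + (\<Sum>b\<in>B. h (Interior b))"
proof -
  have fin: "finite (X \<times> S)" "finite (SIGMA e:E. Q e)" "finite B"
    using assms by auto
  define I1 I2 I3 where "I1 = (\<lambda>(x, M). At_vertex x M) ` (X \<times> S)"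
    and "I2 = (\<lambda>(e, p). Tangential e p) ` (SIGMA e:E. Q e)"
    and "I3 = (\<lambda>(e, p). Normal e p) ` (SIGMA e:E. Q e)"
  note defs = I1_def I2_def I3_def
  have "sum h (dof_index_set X E S Q B) = sum h (I1 \<union> I2 \<union> I3) + sum h (Interior ` B)"
    unfolding dof_index_set_def defs by (rule sum.union_disjoint) (use fin in auto)
  also have "sum h (I1 \<union> I2 \<union> I3) = sum h (I1 \<union> I2) + sum h I3"
    unfolding defs by (rule sum.union_disjoint) (use fin in auto)
  also have "sum h (I1 \<union> I2) = sum h I1 + sum h I2"
    unfolding defs by (rule sum.union_disjoint) (use fin in auto)
  also have "sum h I1 = (\<Sum>x\<in>X. \<Sum>M\<in>S. h (At_vertex x M))"
    unfolding I1_def sum.cartesian_product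
    by (subst sum.reindex) (auto simp: inj_on_def case_prod_beta)
  also have "sum h I2 = (\<Sum>e\<in>E. \<Sum>p\<in>Q e. h (Tangential e p))"
    unfolding I2_def using assms
    by (subst sum.reindex) (auto simp: inj_on_def case_prod_beta sum.Sigma)
  also have "sum h I3 = (\<Sum>e\<in>E. \<Sum>p\<in>Q e. h (Normal e p))"
    unfolding I3_def using assms
    by (subst sum.reindex) (auto simp: inj_on_def case_prod_beta sum.Sigma)
  also have "sum h (Interior ` B) = (\<Sum>b\<in>B. h (Interior b))"
    by (subst sum.reindex) (auto simp: inj_on_def)
  finally show ?thesis .
qed

section \<open>Kernel and independence on one triangle, without bases\<close>

locale framed_triangle =
  fixes k :: nat and f :: "plane set" and \<tau> \<nu> :: "plane set \<Rightarrow> plane"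
  assumes k: "k \<ge> 1" and simplex: "2 simplex f"
    and tangent: "\<And>e. e \<in> edges_of f \<Longrightarrow> unit_tangent e (\<tau> e)"
    and normal: "\<And>e. e \<in> edges_of f \<Longrightarrow> unit_normal e (\<nu> e)"
begin

abbreviation "V \<equiv> sym_poly_space k f"

lemma at_vert:
  assumes "x \<in> verts_of f" obtains y z where "is_triangle x y z f"
proof -
  obtain a b c where "is_triangle a b c f" by (rule simplex_imp_triangle[OF simplex])
  from this assms show thesis by (rule triangle_at_vert) (rule that)
qed

lemma at_edge:
  assumes "e \<in> edges_of f" obtains x y z where "is_triangle x y z f" "e = closed_segment x y" "x \<noteq> y"
proof -
  obtain a b c where "is_triangle a b c f" by (rule simplex_imp_triangle[OF simplex])
  from this assms obtain x y z where "is_triangle x y z f" "e = closed_segment x y"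
    by (rule triangle_at_edge)
  then show thesis using that triangle_distinct by blast
qed

lemma triangle_facts: "compact f" "convex f" "interior f \<noteq> {}"
  "finite (verts_of f)" "card (verts_of f) = 3" "finite (edges_of f)" "card (edges_of f) = 3"
proof -
  obtain a b c where t: "is_triangle a b c f" by (rule simplex_imp_triangle[OF simplex])
  show "compact f" "convex f" "interior f \<noteq> {}" "card (verts_of f) = 3" "card (edges_of f) = 3"
    using t by (rule triangle_compact triangle_convex triangle_interior triangle_card)+
  show "finite (verts_of f)" "finite (edges_of f)"
    by (simp_all add: triangle_verts_of[OF t] triangle_edges_of[OF t])
qed

lemma field_eq_0_if_energy_0:
  assumes "\<sigma> \<in> V" "integral f (\<lambda>x. frob (\<sigma> x) (\<sigma> x)) = 0"
  shows "\<sigma> = 0"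
proof
  fix x
  show "\<sigma> x = 0 x"
  proof (cases "x \<in> f")
    case True
    then have "frob (\<sigma> x) (\<sigma> x) = 0"
      using continuous_nonneg_integral_eq_0[OF triangle_facts(1-3) frob_continuous[OF assms(1,1)] frob_self_nonneg assms(2)]
      by blast
    then show ?thesis by (simp add: frob_self_eq_0)
  next
    case False
    then show ?thesis using sym_poly_space_outside[OF assms(1)] by simp
  qed
qed

text \<open>On each edge the tangential or normal component is a polynomial of degree at most
  \<open>k\<close> vanishing at both ends, with zero moments up to degree
  \<open>k - 2\<close>.\<close>

lemma fields_with_zero_moments:
  assumes \<sigma>: "\<sigma> \<in> V" and v: "\<And>x. x \<in> verts_of f \<Longrightarrow> \<sigma> x = 0"
    and t: "\<And>e p. e \<in> edges_of f \<Longrightarrow> p \<in> poly_space (int k - 2) e \<Longrightarrow> edge_moment e (\<tau> e) p \<sigma> = 0"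
    and n: "\<And>e p. e \<in> edges_of f \<Longrightarrow> p \<in> poly_space (int k - 2) e \<Longrightarrow> edge_moment e (\<nu> e) p \<sigma> = 0"
  shows "\<sigma> \<in> bubble_space k f"
proof -
  have *: "\<forall>x\<in>e. u \<bullet> (\<sigma> x *v u) = 0"
    if e: "e \<in> edges_of f" and u: "\<And>p. p \<in> poly_space (int k - 2) e \<Longrightarrow> edge_moment e u p \<sigma> = 0" for e u
  proof -
    obtain x y z where tri: "is_triangle x y z f" and exy: "e = closed_segment x y" "x \<noteq> y"
      using at_edge[OF e] .
    define g where "g = (\<lambda>x. if x \<in> e then u \<bullet> (\<sigma> x *v u) else 0)"
    have "g \<in> poly_space (int k) (closed_segment x y)"
      unfolding g_def using quadratic_form_mem_poly_space[OF \<sigma> edge_subset[OF e]] exy by simp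
    moreover have "g x = 0" "g y = 0"
      using v triangle_verts_of[OF tri] by (auto simp: g_def)
    moreover have "edge_integral (closed_segment x y) (\<lambda>x. g x * p x) = 0"
      if "p \<in> poly_space (int k - 2) (closed_segment x y)" for p
    proof -
      have "edge_integral (closed_segment x y) (\<lambda>x. g x * p x) = edge_moment e u p \<sigma>"
        unfolding edge_moment_def exy by (rule edge_integral_cong) (simp add: g_def exy)
      then show ?thesis using u that exy by simp
    qed
    ultimately have "g = 0" using edge_poly_eq_0_if_moments_0 exy(2) by blast
    then show ?thesis by (auto simp: g_def fun_eq_iff split: if_splits)
  qed
  have "s \<bullet> (\<sigma> x *v s) = 0 \<and> m \<bullet> (\<sigma> x *v m) = 0"
    if e: "e \<in> edges_of f" and sm: "unit_tangent e s" "unit_normal e m" and x: "x \<in> e" for e s m x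
  proof -
    obtain a b where ab: "e = closed_segment a b" "a \<noteq> b" using at_edge[OF e] by metis
    \<comment> \<open>The bubble space refers to every unit tangent and normal; these are the chosen
      ones up to sign, which the quadratic form ignores.\<close>
    have "s = \<tau> e \<or> s = - \<tau> e" using unit_tangent_unique ab sm tangent[OF e] by metis
    moreover have "m = \<nu> e \<or> m = - \<nu> e" using unit_normal_unique ab sm normal[OF e] by metis
    ultimately show ?thesis
      using *[OF e t[OF e]] *[OF e n[OF e]] x quadratic_form_neg by metis
  qed
  then show ?thesis using \<sigma> v by (auto simp: bubble_space_def)
qed

lemma bubble_edge_moments:
  assumes "b \<in> bubble_space k f" "e \<in> edges_of f"
  shows "edge_moment e (\<tau> e) p b = 0" "edge_moment e (\<nu> e) p b = 0"
proof -
  obtain x y where "e = closed_segment x y" using at_edge[OF assms(2)] by metis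
  moreover have "\<forall>x\<in>e. \<tau> e \<bullet> (b x *v \<tau> e) = 0 \<and> \<nu> e \<bullet> (b x *v \<nu> e) = 0"
    using assms tangent[OF assms(2)] normal[OF assms(2)] unfolding bubble_space_def by blast
  ultimately show "edge_moment e (\<tau> e) p b = 0" "edge_moment e (\<nu> e) p b = 0"
    using edge_moment_eq_0 by blast+
qed

text \<open>A test field felt on \<open>e\<close> only: the product of the barycentric coordinates
  of its endpoints vanishes at all vertices and on the other two edges. \<open>M\<close> decides
  which component on \<open>e\<close> sees it, and the moment against \<open>p\<close> is then the
  integral of p^2 with weight t (1 - t).\<close>

lemma edge_field:
  assumes e: "e \<in> edges_of f" and p: "p \<in> poly_space (int k - 2) e" and M: "M \<in> sym_mats"
  obtains \<sigma> where "\<sigma> \<in> V" "\<And>x. x \<in> verts_of f \<Longrightarrow> \<sigma> x = 0"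
    "\<And>d u q. d \<in> edges_of f \<Longrightarrow> d \<noteq> e \<Longrightarrow> edge_moment d u q \<sigma> = 0"
    "\<And>u q. u \<bullet> (M *v u) = 0 \<Longrightarrow> edge_moment e u q \<sigma> = 0"
    "\<And>u. u \<bullet> (M *v u) = 1 \<Longrightarrow> edge_moment e u p \<sigma> = 0 \<Longrightarrow> p = 0"
proof -
  obtain x y z where tri: "is_triangle x y z f" and exy: "e = closed_segment x y" "x \<noteq> y"
    using at_edge[OF e] .
  obtain P where P: "P \<in> poly_space (int k - 2) f" "\<forall>w\<in>e. P w = p w"
    using poly_space_extend[OF edge_subset[OF e] p] by blast
  define l where "l = (\<lambda>w. bary x y z w * bary y x z w)"
  define \<sigma> where "\<sigma> = tensor (\<lambda>w. bary x y z w * (bary y x z w * P w)) M"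
  \<comment> \<open>Two affine factors raise the degree bound \<open>k - 2\<close> to exactly
    \<open>k\<close>.\<close>
  have "(\<lambda>w. bary x y z w * (bary y x z w * P w)) \<in> poly_space (int k - 2 + 1 + 1) f"
    by (intro affine_mult_mem_poly_space affine_fun_bary P)
  then have "\<sigma> \<in> V" unfolding \<sigma>_def using M by (auto intro: tensor_mem)
  moreover have "\<sigma> w = 0" if "w \<in> verts_of f" for w
    using that bary_vertex[OF tri] bary_vertex[OF triangle_swap[OF tri]]
    by (auto simp: triangle_verts_of[OF tri] \<sigma>_def tensor_def)
  moreover have "edge_moment d u q \<sigma> = 0" if d: "d \<in> edges_of f" "d \<noteq> e" for d u q
  proof -
    have "d = closed_segment y z \<or> d = closed_segment x z"
      using d exy triangle_edges_of[OF tri] by auto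
    moreover have "\<sigma> w = 0" if "w \<in> closed_segment y z \<or> w \<in> closed_segment x z" for w
      using that bary_linepath[OF tri] by (auto simp: \<sigma>_def tensor_def elim!: closed_segmentE_linepath)
    ultimately show ?thesis
      by (elim disjE; simp) (rule edge_moment_eq_0; simp add: quadratic_form_eq)+
  qed
  moreover have "edge_moment e u q \<sigma> = 0" if "u \<bullet> (M *v u) = 0" for u q
    unfolding exy by (rule edge_moment_eq_0) (simp add: that \<sigma>_def tensor_def flip: scaleR_matrix_vector_assoc)
  moreover have "p = 0" if u: "u \<bullet> (M *v u) = 1" and z: "edge_moment e u p \<sigma> = 0" for u
  proof -
    have "edge_moment e u p \<sigma> = edge_integral e (\<lambda>w. l w * p w * p w)"
      unfolding edge_moment_def exy using P(2) exy
      by (intro edge_integral_cong)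
        (simp add: u \<sigma>_def tensor_def l_def mult.assoc flip: scaleR_matrix_vector_assoc)
    then have "edge_integral (closed_segment x y) (\<lambda>w. l w * p w * p w) = 0" using z exy by simp
    moreover have "l (linepath x y t) = t * (1 - t)" for t
      using bary_linepath[OF tri] by (simp add: l_def mult.commute)
    ultimately show ?thesis
      using edge_poly_eq_0_if_bubble_weighted[OF exy(2), of p "int k - 2" l] p exy by blast
  qed
  ultimately show thesis by (rule that)
qed

text \<open>The order matters. Bubbles have neither vertex values nor edge moments, so
  \<open>b\<close> goes first. Edge fields have no vertex values but may have interior moments. The
  vertex fields may have edge and interior moments, so they come last.\<close>

lemma independence:
  assumes A: "\<And>x. x \<in> verts_of f \<Longrightarrow> A x \<in> sym_mats"
    and p: "\<And>e. e \<in> edges_of f \<Longrightarrow> p e \<in> poly_space (int k - 2) e"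
    and q: "\<And>e. e \<in> edges_of f \<Longrightarrow> q e \<in> poly_space (int k - 2) e"
    and b: "b \<in> bubble_space k f"
    and zero: "\<And>\<sigma>. \<sigma> \<in> V \<Longrightarrow>
      (\<Sum>x\<in>verts_of f. frob (\<sigma> x) (A x)) + (\<Sum>e\<in>edges_of f. edge_moment e (\<tau> e) (p e) \<sigma>)
      + (\<Sum>e\<in>edges_of f. edge_moment e (\<nu> e) (q e) \<sigma>) + integral f (\<lambda>x. frob (\<sigma> x) (b x)) = 0"
  shows "\<forall>x\<in>verts_of f. A x = 0" "\<forall>e\<in>edges_of f. p e = 0" "\<forall>e\<in>edges_of f. q e = 0" "b = 0"
proof -
  have bV: "b \<in> V" "\<And>x. x \<in> verts_of f \<Longrightarrow> b x = 0" using b by (auto simp: bubble_space_def)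
  show b0: "b = 0"
    by (rule field_eq_0_if_energy_0[OF bV(1)])
      (use zero[OF bV(1)] bubble_edge_moments[OF b] bV(2) in simp)
  note zero' = zero[unfolded b0, simplified]
  show p0: "\<forall>e\<in>edges_of f. p e = 0"
  proof
    fix e assume e: "e \<in> edges_of f"
    have tn: "\<tau> e \<bullet> \<tau> e = 1" "\<nu> e \<bullet> \<tau> e = 0"
      using tangent[OF e] tangent_normal_orthogonal[OF tangent[OF e] normal[OF e]]
      by (simp_all add: unit_tangent_def norm_eq_1)
    obtain \<sigma> where \<sigma>: "\<sigma> \<in> V" "\<And>x. x \<in> verts_of f \<Longrightarrow> \<sigma> x = 0"
      "\<And>d u q. d \<in> edges_of f \<Longrightarrow> d \<noteq> e \<Longrightarrow> edge_moment d u q \<sigma> = 0"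
      "\<And>u q. u \<bullet> (outer (\<tau> e) *v u) = 0 \<Longrightarrow> edge_moment e u q \<sigma> = 0"
      "\<And>u. u \<bullet> (outer (\<tau> e) *v u) = 1 \<Longrightarrow> edge_moment e u (p e) \<sigma> = 0 \<Longrightarrow> p e = 0"
      using edge_field[OF e p[OF e] outer_sym] by metis
    have "edge_moment d (\<nu> d) (q d) \<sigma> = 0" if "d \<in> edges_of f" for d
      using \<sigma>(3)[OF that] \<sigma>(4)[of "\<nu> e"] tn by (cases "d = e") (auto simp: quadratic_form_outer)
    moreover have "(\<Sum>d\<in>edges_of f. edge_moment d (\<tau> d) (p d) \<sigma>) = edge_moment e (\<tau> e) (p e) \<sigma>"
      using \<sigma>(3) e triangle_facts(6) by (intro sum.remove[OF _ e, THEN trans]) auto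
    ultimately have "edge_moment e (\<tau> e) (p e) \<sigma> = 0" using zero'[OF \<sigma>(1)] \<sigma>(2) by simp
    then show "p e = 0" using \<sigma>(5)[of "\<tau> e"] tn by (simp add: quadratic_form_outer)
  qed
  show q0: "\<forall>e\<in>edges_of f. q e = 0"
  proof
    fix e assume e: "e \<in> edges_of f"
    have tn: "\<nu> e \<bullet> \<nu> e = 1" "\<tau> e \<bullet> \<nu> e = 0"
      using normal[OF e] tangent_normal_orthogonal[OF tangent[OF e] normal[OF e]]
      by (simp_all add: unit_normal_def norm_eq_1 inner_commute)
    obtain \<sigma> where \<sigma>: "\<sigma> \<in> V" "\<And>x. x \<in> verts_of f \<Longrightarrow> \<sigma> x = 0"
      "\<And>d u q. d \<in> edges_of f \<Longrightarrow> d \<noteq> e \<Longrightarrow> edge_moment d u q \<sigma> = 0"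
      "\<And>u q. u \<bullet> (outer (\<nu> e) *v u) = 0 \<Longrightarrow> edge_moment e u q \<sigma> = 0"
      "\<And>u. u \<bullet> (outer (\<nu> e) *v u) = 1 \<Longrightarrow> edge_moment e u (q e) \<sigma> = 0 \<Longrightarrow> q e = 0"
      using edge_field[OF e q[OF e] outer_sym] by metis
    have "edge_moment d (\<tau> d) (p d) \<sigma> = 0" if "d \<in> edges_of f" for d
      using \<sigma>(3)[OF that] \<sigma>(4)[of "\<tau> e"] tn by (cases "d = e") (auto simp: quadratic_form_outer)
    moreover have "(\<Sum>d\<in>edges_of f. edge_moment d (\<nu> d) (q d) \<sigma>) = edge_moment e (\<nu> e) (q e) \<sigma>"
      using \<sigma>(3) e triangle_facts(6) by (intro sum.remove[OF _ e, THEN trans]) auto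
    ultimately have "edge_moment e (\<nu> e) (q e) \<sigma> = 0" using zero'[OF \<sigma>(1)] \<sigma>(2) by simp
    then show "q e = 0" using \<sigma>(5)[of "\<nu> e"] tn by (simp add: quadratic_form_outer)
  qed
  have em0: "edge_moment e u 0 \<sigma> = 0" if "e \<in> edges_of f" for e u \<sigma>
    using at_edge[OF that] edge_moment_zero_weight by metis
  show "\<forall>x\<in>verts_of f. A x = 0"
  proof
    fix a assume a: "a \<in> verts_of f"
    obtain x y where tri: "is_triangle a x y f" using at_vert[OF a] .
    \<comment> \<open>The indicator cuts the affine coordinate off outside \<open>f\<close>, as
      fields are extended by zero. Its degree 1 fits because of \<open>k \<ge> 1\<close>.\<close>
    define \<sigma> where "\<sigma> = tensor (\<lambda>w. bary a x y w * (if w \<in> f then 1 else 0)) (A a)"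
    have "(\<lambda>w. bary a x y w * (if w \<in> f then 1 else 0)) \<in> poly_space (0 + 1) f"
      by (intro affine_mult_mem_poly_space affine_fun_bary const_mem_poly_space) simp
    then have "\<sigma> \<in> V"
      unfolding \<sigma>_def using k A[OF a] by (intro tensor_mem poly_space_mono[of "0 + 1" "int k"]) auto
    moreover have "\<sigma> a = A a" "\<sigma> x = 0" "\<sigma> y = 0"
      using bary_vertex[OF tri] tri hull_inc[of a "{a, x, y}" convex]
      by (auto simp: \<sigma>_def tensor_def is_triangle_def)
    ultimately have "frob (A a) (A a) = 0"
      using zero'[of \<sigma>] p0 q0 em0 triangle_distinct[OF tri] by (simp add: triangle_verts_of[OF tri])
    then show "A a = 0" by (rule frob_self_eq_0)
  qed
qed

end

section \<open>Unisolvence and the size of a bubble basis\<close>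

locale local_dofs = framed_triangle +
  fixes S :: "mat2 set" and Q :: "plane set \<Rightarrow> (plane \<Rightarrow> real) set" and B :: "tensor_field set"
  assumes S: "is_basis_of S sym_mats"
    and Q: "\<And>e. e \<in> edges_of f \<Longrightarrow> is_basis_of (Q e) (poly_space (int k - 2) e)"
    and B: "is_basis_of B (bubble_space k f)"
begin

abbreviation "I \<equiv> dof_indices f S Q B"

lemma basis_sets: "finite S" "card S = 3" "S \<subseteq> sym_mats" "independent S"
proof -
  show ind: "independent S" and "S \<subseteq> sym_mats"
    using S span_superset[of S] by (auto simp: is_basis_of_def)
  show "finite S" using ind by (rule independent_imp_finite)
  have "card S = dim (span S)" by (rule dim_span_eq_card_independent[OF ind, symmetric])
  also have "\<dots> = 3" using S by (simp only: is_basis_of_def dim_sym_mats)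
  finally show "card S = 3" .
qed

lemma basis_Q:
  assumes "e \<in> edges_of f"
  shows "finite (Q e)" "card (Q e) = k - 1" "Q e \<subseteq> poly_space (int k - 2) e" "independent (Q e)"
proof -
  obtain a b where ab: "e = closed_segment a b" "a \<noteq> b" using at_edge[OF assms] by metis
  \<comment> \<open>The natural number \<open>k - 1\<close> is the dimension of the edge weights; it
    is 0 for \<open>k = 1\<close>.\<close>
  have m: "int k - 2 = int (k - 1) - 1" using k by simp
  show ind: "independent (Q e)" and sub: "Q e \<subseteq> poly_space (int k - 2) e"
    using Q[OF assms] span_superset[of "Q e"] by (auto simp: is_basis_of_def)
  have "card (Q e) = dim (span (Q e))" by (rule dim_span_eq_card_independent[OF ind, symmetric])
  also have "\<dots> = dim (poly_space (int (k - 1) - 1) (closed_segment a b))"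
    using Q[OF assms] by (simp only: is_basis_of_def m ab)
  finally show "card (Q e) = k - 1"
    by (simp only: dim_poly_space_segment(1)[OF ab(2)])
  obtain T where "finite T" "span T = poly_space (int k - 2) e"
    using dim_poly_space_segment(2)[OF ab(2), of "k - 1"] unfolding is_basis_of_def m ab by blast
  then show "finite (Q e)" using independent_span_bound[OF _ ind, of T] sub by simp
qed

lemma basis_B: "finite B" "B \<subseteq> bubble_space k f" "independent B"
proof -
  show ind: "independent B" and sub: "B \<subseteq> bubble_space k f"
    using B span_superset[of B] by (auto simp: is_basis_of_def)
  obtain T where "finite T" "V = span T"
    using sym_poly_space_dim(2)[OF triangle_facts(3)] by blast
  then show "finite B"
    using independent_span_bound[OF _ ind, of T] sub bubble_space_subset[of k f] by auto
qed

lemma dof_indices_eq: "I = dof_index_set (verts_of f) (edges_of f) S Q B"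
  by (auto simp: dof_indices_def dof_index_set_def)

lemma finite_I: "finite I"
  unfolding dof_indices_eq
  by (intro finite_dof_index_set triangle_facts basis_sets(1) basis_Q(1) basis_B(1))

lemma sum_dof_indices:
  "(\<Sum>i\<in>I. h i) = (\<Sum>x\<in>verts_of f. \<Sum>M\<in>S. h (At_vertex x M))
     + (\<Sum>e\<in>edges_of f. \<Sum>p\<in>Q e. h (Tangential e p))
     + (\<Sum>e\<in>edges_of f. \<Sum>p\<in>Q e. h (Normal e p)) + (\<Sum>b\<in>B. h (Interior b))"
  unfolding dof_indices_eq
  by (intro sum_dof_index_set triangle_facts basis_sets(1) basis_Q(1) basis_B(1))

text \<open>Three matrix forms at each of three vertices, and two components with
  \<open>k - 1\<close> weights on each of three edges.\<close>

lemma card_I: "card I = 9 + 6 * (k - 1) + card B"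
proof -
  have "card I = (\<Sum>i\<in>I. 1)" by simp
  also have "\<dots> = 9 + 6 * (k - 1) + card B"
    unfolding sum_dof_indices using triangle_facts basis_sets basis_Q by simp
  finally show ?thesis .
qed

lemma dof_linear:
  assumes "i \<in> I"
  shows "linear_form_on V (dof f \<tau> \<nu> i)"
proof -
  have "linear_form_on V (edge_moment e u p)" if e: "e \<in> edges_of f" and p: "p \<in> Q e" for e u p
  proof -
    obtain a b where ab: "e = closed_segment a b" using at_edge[OF e] by metis
    have "p \<in> poly_space (int k - 2) e" using basis_Q(3)[OF e] p by blast
    then show ?thesis using edge_moment_linear_field edge_subset[OF e] unfolding ab by blast
  qed
  moreover have "linear_form_on V (\<lambda>\<sigma>. integral f (\<lambda>x. frob (\<sigma> x) (b x)))" if "b \<in> B" for b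
    using interior_moment_linear[OF triangle_facts(1)] that basis_B bubble_space_subset by blast
  moreover have "linear_form_on V (\<lambda>\<sigma>. frob (\<sigma> x) M)" for x M
    by (simp add: linear_form_on_def frob_eq algebra_simps)
  moreover have "dof f \<tau> \<nu> (At_vertex x M) = (\<lambda>\<sigma>. frob (\<sigma> x) M)"
    "dof f \<tau> \<nu> (Tangential e p) = edge_moment e (\<tau> e) p"
    "dof f \<tau> \<nu> (Normal e p) = edge_moment e (\<nu> e) p"
    "dof f \<tau> \<nu> (Interior b) = (\<lambda>\<sigma>. integral f (\<lambda>x. frob (\<sigma> x) (b x)))" for x M e p b
    by (auto simp: fun_eq_iff)
  ultimately show ?thesis using assms by (auto simp: dof_indices_def)
qed

text \<open>Agreement extends by linearity from \<open>S\<close> to all symmetric test matrices,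
  among them \<open>A - A'\<close>.\<close>

lemma vertex_value_eq:
  assumes "A \<in> sym_mats" "A' \<in> sym_mats" "\<And>M. M \<in> S \<Longrightarrow> frob A M = frob A' M"
  shows "A = A'"
proof -
  have "A - A' \<in> sym_mats" using assms by (auto intro: subspace_diff)
  then have "frob A (A - A') = frob A' (A - A')"
    using S by (intro linear_form_on_eq_on_span[OF _ frob_linear frob_linear assms(3)]) (auto simp: is_basis_of_def)
  then have "frob (A - A') (A - A') = 0" by (simp add: frob_eq algebra_simps)
  then show ?thesis using frob_self_eq_0 by fastforce
qed

text \<open>The second field may live on another triangle, so this serves both the kernel, with the
  zero field, and the gluing across an edge.\<close>

lemma edge_moments_eq:
  assumes "e \<in> edges_of f" "e \<subseteq> g" "\<sigma> \<in> V" "\<rho> \<in> sym_poly_space k g"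
    and "\<And>p. p \<in> Q e \<Longrightarrow> edge_moment e u p \<sigma> = edge_moment e u p \<rho>" and "p \<in> poly_space (int k - 2) e"
  shows "edge_moment e u p \<sigma> = edge_moment e u p \<rho>"
proof -
  obtain a b where ab: "e = closed_segment a b" using at_edge[OF assms(1)] by metis
  have "span (Q e) = poly_space (int k - 2) e" using Q assms(1) by (simp add: is_basis_of_def)
  moreover have "linear_form_on (poly_space (int k - 2) e) (\<lambda>p. edge_moment e u p \<sigma>)"
    "linear_form_on (poly_space (int k - 2) e) (\<lambda>p. edge_moment e u p \<rho>)"
    using edge_moment_linear_weight edge_subset[OF assms(1)] assms(2-4) unfolding ab by blast+
  ultimately show ?thesis by (rule linear_form_on_eq_on_span) (use assms(5,6) in auto)
qed

lemma dof_kernel: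
  assumes \<sigma>: "\<sigma> \<in> V" and z: "\<And>i. i \<in> I \<Longrightarrow> dof f \<tau> \<nu> i \<sigma> = 0"
  shows "\<sigma> = 0"
proof -
  have zV: "0 \<in> V" by (rule subspace_0) simp
  have "\<sigma> x = 0" if "x \<in> verts_of f" for x
    using vertex_value_eq[of "\<sigma> x" 0] sym_poly_space_sym[OF \<sigma>] z[of "At_vertex x _"] that
    by (force simp: dof_indices_def intro: subspace_0)
  moreover have "edge_moment e u 0 \<sigma> = 0" if "e \<in> edges_of f" for e u
    using at_edge[OF that] edge_moment_zero_weight by metis
  moreover have "edge_moment e u p 0 = 0" if "e \<in> edges_of f" for e u p
    using at_edge[OF that] edge_moment_eq_0[of _ _ u 0 p] by (metis inner_zero_right matrix_vector_mult_0 zero_fun_apply)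
  moreover have "edge_moment e (\<tau> e) p \<sigma> = edge_moment e (\<tau> e) p 0"
    "edge_moment e (\<nu> e) p \<sigma> = edge_moment e (\<nu> e) p 0"
    if "e \<in> edges_of f" "p \<in> poly_space (int k - 2) e" for e p
  proof -
    have "dof f \<tau> \<nu> (Tangential e q) \<sigma> = 0" "dof f \<tau> \<nu> (Normal e q) \<sigma> = 0" if "q \<in> Q e" for q
      using that z[of "Tangential e q"] z[of "Normal e q"] \<open>e \<in> edges_of f\<close>
      by (simp_all add: dof_indices_def)
    then show "edge_moment e (\<tau> e) p \<sigma> = edge_moment e (\<tau> e) p 0"
      "edge_moment e (\<nu> e) p \<sigma> = edge_moment e (\<nu> e) p 0"
      using edge_moments_eq[OF that(1) edge_subset[OF that(1)] \<sigma> zV _ that(2)] calculation(3)[OF that(1)]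
      by simp_all
  qed
  ultimately have b: "\<sigma> \<in> bubble_space k f" using fields_with_zero_moments[OF \<sigma>] by metis
  have "linear_form_on V (\<lambda>b. integral f (\<lambda>x. frob (b x) (\<sigma> x)))"
    using interior_moment_linear[OF triangle_facts(1) \<sigma>] .
  then have lin: "linear_form_on (bubble_space k f) (\<lambda>b. integral f (\<lambda>x. frob (b x) (\<sigma> x)))"
    using bubble_space_subset unfolding linear_form_on_def by blast
  \<comment> \<open>The moments vanish against \<open>B\<close>, hence against its whole span, to
    which \<open>\<sigma>\<close> belongs.\<close>
  have "integral f (\<lambda>x. frob (\<sigma> x) (\<sigma> x)) = 0"
  proof (rule linear_form_on_eq_on_span[of B "bubble_space k f" _ "\<lambda>b. 0", OF _ lin _ _ b])
    show "integral f (\<lambda>x. frob (b x) (\<sigma> x)) = 0" if "b \<in> B" for b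
      using z[of "Interior b"] that by (simp add: dof_indices_def frob_commute)
  qed (use B in \<open>auto simp: is_basis_of_def linear_form_on_def\<close>)
  then show ?thesis by (rule field_eq_0_if_energy_0[OF \<sigma>])
qed

lemma dof_independent:
  assumes c: "\<And>\<sigma>. \<sigma> \<in> V \<Longrightarrow> (\<Sum>i\<in>I. c i * dof f \<tau> \<nu> i \<sigma>) = 0"
  shows "\<forall>i\<in>I. c i = 0"
proof -
  define A where "A x = (\<Sum>M\<in>S. c (At_vertex x M) *\<^sub>R M)" for x
  define p where "p e = (\<Sum>q\<in>Q e. c (Tangential e q) *\<^sub>R q)" for e
  define r where "r e = (\<Sum>q\<in>Q e. c (Normal e q) *\<^sub>R q)" for e
  define b where "b = (\<Sum>d\<in>B. c (Interior d) *\<^sub>R d)"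
  have A: "A x \<in> sym_mats" for x
    unfolding A_def using basis_sets by (auto intro!: subspace_sum subspace_scale)
  have pr: "p e \<in> poly_space (int k - 2) e" "r e \<in> poly_space (int k - 2) e" if "e \<in> edges_of f" for e
    unfolding p_def r_def using basis_Q(3)[OF that] by (auto intro!: subspace_sum subspace_scale)
  have sB: "subspace (bubble_space k f)" using B subspace_span[of B] by (simp add: is_basis_of_def)
  have b: "b \<in> bubble_space k f"
    unfolding b_def using sB basis_B(2) by (auto intro!: subspace_sum subspace_scale)
  have "(\<Sum>x\<in>verts_of f. frob (\<sigma> x) (A x)) + (\<Sum>e\<in>edges_of f. edge_moment e (\<tau> e) (p e) \<sigma>)
      + (\<Sum>e\<in>edges_of f. edge_moment e (\<nu> e) (r e) \<sigma>) + integral f (\<lambda>x. frob (\<sigma> x) (b x)) = 0"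
    if \<sigma>: "\<sigma> \<in> V" for \<sigma>
  proof -
    have "frob (\<sigma> x) (A x) = (\<Sum>M\<in>S. c (At_vertex x M) * frob (\<sigma> x) M)" for x
      unfolding A_def by (rule linear_form_on_sum[OF subspace_UNIV frob_linear]) simp
    moreover have "edge_moment e u (\<Sum>q\<in>Q e. g q *\<^sub>R q) \<sigma> = (\<Sum>q\<in>Q e. g q * edge_moment e u q \<sigma>)"
      if e: "e \<in> edges_of f" for e u g
    proof -
      obtain x y where xy: "e = closed_segment x y" using at_edge[OF e] by metis
      have "linear_form_on (poly_space (int k - 2) e) (\<lambda>p. edge_moment e u p \<sigma>)"
        using edge_moment_linear_weight edge_subset[OF e] \<sigma> unfolding xy by blast
      then show ?thesis
        using linear_form_on_sum[OF subspace_poly_space, of "int k - 2" e _ "Q e" "\<lambda>q. q" g] basis_Q(3)[OF e]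
        by blast
    qed
    moreover have "integral f (\<lambda>x. frob (\<sigma> x) (b x)) = (\<Sum>d\<in>B. c (Interior d) * integral f (\<lambda>x. frob (\<sigma> x) (d x)))"
    proof -
      have "integral f (\<lambda>x. frob (b x) (\<sigma> x)) = (\<Sum>d\<in>B. c (Interior d) * integral f (\<lambda>x. frob (d x) (\<sigma> x)))"
        unfolding b_def
        by (rule linear_form_on_sum[OF subspace_sym_poly_space interior_moment_linear[OF triangle_facts(1) \<sigma>]])
          (use basis_B bubble_space_subset in blast)
      then show ?thesis by (simp add: frob_commute)
    qed
    ultimately show ?thesis
      using c[OF \<sigma>] unfolding sum_dof_indices by (simp add: p_def r_def cong: sum.cong)
  qed
  note zero = independence[OF A pr b this]
  have "c (At_vertex x M) = 0" if "x \<in> verts_of f" "M \<in> S" for x M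
    using independentD[OF basis_sets(4,1) order_refl _ that(2), of "\<lambda>M. c (At_vertex x M)"] zero(1) that(1)
    by (simp add: A_def)
  moreover have "c (Tangential e q) = 0" "c (Normal e q) = 0" if "e \<in> edges_of f" "q \<in> Q e" for e q
    using independentD[OF basis_Q(4)[OF that(1)] basis_Q(1)[OF that(1)] order_refl _ that(2), of "\<lambda>q. c (Tangential e q)"]
      independentD[OF basis_Q(4)[OF that(1)] basis_Q(1)[OF that(1)] order_refl _ that(2), of "\<lambda>q. c (Normal e q)"]
      zero(2,3) that(1)
    by (simp_all add: p_def r_def)
  moreover have "c (Interior d) = 0" if "d \<in> B" for d
    using independentD[OF basis_B(3,1) order_refl _ that, of "\<lambda>d. c (Interior d)"] zero(4)
    by (simp add: b_def)
  ultimately show ?thesis by (auto simp: dof_indices_def)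
qed

lemma nodal_fields_exist: "\<exists>w. \<forall>i\<in>I. w i \<in> V \<and> (\<forall>j\<in>I. dof f \<tau> \<nu> j (w i) = of_bool (i = j))"
proof (rule dual_vectors_exist[OF subspace_sym_poly_space finite_I])
  show "linear_form_on V (dof f \<tau> \<nu> i)" if "i \<in> I" for i
    using that by (rule dof_linear)
  show "\<forall>i\<in>I. c i = 0" if "\<And>\<sigma>. \<sigma> \<in> V \<Longrightarrow> (\<Sum>i\<in>I. c i * dof f \<tau> \<nu> i \<sigma>) = 0" for c
    using that by (rule dof_independent)
qed

lemma unisolvent_dofs: "unisolvent V I (dof f \<tau> \<nu>)"
proof -
  obtain w where w: "\<And>i. i \<in> I \<Longrightarrow> w i \<in> V"
    "\<And>i j. i \<in> I \<Longrightarrow> j \<in> I \<Longrightarrow> dof f \<tau> \<nu> j (w i) = of_bool (i = j)"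
    using nodal_fields_exist by blast
  show ?thesis
    by (rule unisolvent_if_dual_vectors[where L = "dof f \<tau> \<nu>" and w = w, OF subspace_sym_poly_space finite_I];
        (fact dof_linear dof_kernel w)?)
qed

text \<open>Duality gives \<open>dim V = card I\<close>; comparing with the known dimension of
  \<open>V\<close> leaves \<open>card B\<close> as the only unknown.\<close>

lemma card_B: "2 * card B = 3 * (k * (k - 1))"
proof -
  obtain w where w: "\<And>i. i \<in> I \<Longrightarrow> w i \<in> V"
    "\<And>i j. i \<in> I \<Longrightarrow> j \<in> I \<Longrightarrow> dof f \<tau> \<nu> j (w i) = of_bool (i = j)"
    using nodal_fields_exist by blast
  have "dim V = card I"
    by (rule dim_eq_card_forms[where L = "dof f \<tau> \<nu>" and w = w, OF subspace_sym_poly_space finite_I];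
        (fact dof_linear dof_kernel w)?)
  then have "2 * (9 + 6 * (k - 1) + card B) = 3 * ((k + 1) * (k + 2))"
    using sym_poly_space_dim(1)[OF triangle_facts(3), of k] card_I by simp
  moreover obtain n where "k = Suc n" using k by (cases k) auto
  ultimately show ?thesis by (simp add: algebra_simps)
qed

end

section \<open>The global space\<close>

lemma subspace_bubble_space: "subspace (bubble_space k f)"
proof -
  have "(A + B) *v u = A *v u + B *v u" "(c *\<^sub>R A) *v u = c *\<^sub>R (A *v u)" for A B :: mat2 and u :: plane and c
    by (simp_all add: matrix_vector_mult_add_rdistrib scaleR_matrix_vector_assoc)
  moreover have "0 \<in> sym_poly_space k f" by (rule subspace_0) simp
  ultimately show ?thesis
    unfolding subspace_def bubble_space_def
    by (auto simp: inner_add_right subspace_add subspace_scale)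
qed

lemma basis_of_subspace: "subspace V \<Longrightarrow> \<exists>B. is_basis_of B V"
  using basis_exists[of V] span_subspace unfolding is_basis_of_def by metis

lemma subspace_fe_space:
  assumes "\<And>f. f \<in> F \<Longrightarrow> 2 simplex f"
  shows "subspace (fe_space k F)"
proof -
  have lin: "linear_form_on (sym_poly_space k f) (edge_moment e u p)"
    if f: "f \<in> F" and e: "e \<in> edges_of f" and p: "p \<in> poly_space (int k - 2) e" for f e u p
  proof -
    obtain a b c where "is_triangle a b c f" by (rule simplex_imp_triangle[OF assms[OF f]])
    from this e obtain x y z where "e = closed_segment x y" by (rule triangle_at_edge)
    then show ?thesis using edge_moment_linear_field edge_subset[OF e] p by blast
  qed
  have V0: "0 \<in> sym_poly_space k f" for f by (rule subspace_0) simp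
  have add: "edge_moment e u p (\<sigma> + \<rho>) = edge_moment e u p \<sigma> + edge_moment e u p \<rho>"
    if "f \<in> F" "e \<in> edges_of f" "p \<in> poly_space (int k - 2) e" "\<sigma> \<in> sym_poly_space k f" "\<rho> \<in> sym_poly_space k f"
    for f e u p \<sigma> \<rho>
    using lin[OF that(1-3)] that(4,5) by (simp add: linear_form_on_def)
  have scale: "edge_moment e u p (r *\<^sub>R \<sigma>) = r * edge_moment e u p \<sigma>"
    if "f \<in> F" "e \<in> edges_of f" "p \<in> poly_space (int k - 2) e" "\<sigma> \<in> sym_poly_space k f"
    for f e u p \<sigma> r
    using lin[OF that(1-3)] that(4) by (simp add: linear_form_on_def)
  have mem: "\<sigma> f \<in> sym_poly_space k f" if "\<sigma> \<in> fe_space k F" "f \<in> F" for \<sigma> f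
    using that unfolding fe_space_def by blast
  have out: "\<sigma> f = 0" if "\<sigma> \<in> fe_space k F" "f \<notin> F" for \<sigma> f
    using that unfolding fe_space_def by blast
  have vert: "\<sigma> f x = \<sigma> g x" if "\<sigma> \<in> fe_space k F" "f \<in> F" "g \<in> F" "x \<in> verts_of f \<inter> verts_of g" for \<sigma> f g x
    using that unfolding fe_space_def by blast
  have moment: "edge_moment e t p (\<sigma> f) = edge_moment e t p (\<sigma> g) \<and> edge_moment e n p (\<sigma> f) = edge_moment e n p (\<sigma> g)"
    if "\<sigma> \<in> fe_space k F" "f \<in> F" "g \<in> F" "e \<in> edges_of f \<inter> edges_of g" "unit_tangent e t \<and> unit_normal e n"
      "p \<in> poly_space (int k - 2) e" for \<sigma> f g e t n p
    using that unfolding fe_space_def by blast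
  have combination: "r *\<^sub>R \<sigma> + \<rho> \<in> fe_space k F" if \<sigma>: "\<sigma> \<in> fe_space k F" and \<rho>: "\<rho> \<in> fe_space k F" for r \<sigma> \<rho>
    unfolding fe_space_def
  proof (intro CollectI conjI ballI allI impI)
    show "(r *\<^sub>R \<sigma> + \<rho>) f \<in> sym_poly_space k f" if "f \<in> F" for f
      using mem[OF \<sigma> that] mem[OF \<rho> that] by (simp add: subspace_add subspace_scale)
    show "(r *\<^sub>R \<sigma> + \<rho>) f = 0" if "f \<notin> F" for f
      using out[OF \<sigma> that] out[OF \<rho> that] by simp
  next
    fix f g x assume "f \<in> F" "g \<in> F" "x \<in> verts_of f \<inter> verts_of g"
    then show "(r *\<^sub>R \<sigma> + \<rho>) f x = (r *\<^sub>R \<sigma> + \<rho>) g x"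
      using vert[OF \<sigma>, of f g x] vert[OF \<rho>, of f g x] by simp
  next
    fix f g e t n p
    assume fg: "f \<in> F" "g \<in> F" and e: "e \<in> edges_of f \<inter> edges_of g"
      and tn: "unit_tangent e t \<and> unit_normal e n" and p: "p \<in> poly_space (int k - 2) e"
    have "edge_moment e u p ((r *\<^sub>R \<sigma> + \<rho>) h) = r * edge_moment e u p (\<sigma> h) + edge_moment e u p (\<rho> h)"
      if "h = f \<or> h = g" for h u
    proof -
      have h: "h \<in> F" "e \<in> edges_of h" using that fg e by auto
      show ?thesis
        using add[OF h p] scale[OF h p] mem[OF \<sigma> h(1)] mem[OF \<rho> h(1)] by (simp add: subspace_scale)
    qed
    then show "edge_moment e t p ((r *\<^sub>R \<sigma> + \<rho>) f) = edge_moment e t p ((r *\<^sub>R \<sigma> + \<rho>) g)"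
      "edge_moment e n p ((r *\<^sub>R \<sigma> + \<rho>) f) = edge_moment e n p ((r *\<^sub>R \<sigma> + \<rho>) g)"
      using moment[OF \<sigma> fg e tn p] moment[OF \<rho> fg e tn p] by simp_all
  qed
  have zero: "0 \<in> fe_space k F" using V0 by (simp add: fe_space_def)
  show ?thesis
    unfolding subspace_def
  proof (intro conjI ballI allI)
    show "0 \<in> fe_space k F" by (rule zero)
    show "\<sigma> + \<rho> \<in> fe_space k F" if "\<sigma> \<in> fe_space k F" "\<rho> \<in> fe_space k F" for \<sigma> \<rho>
      using combination[OF that, of 1] by simp
    show "r *\<^sub>R \<sigma> \<in> fe_space k F" if "\<sigma> \<in> fe_space k F" for r \<sigma>
      using combination[OF that zero, of r] by simp
  qed
qed

text \<open>Vertex and edge indices are shared between triangles, whereas interior ones are tagged by their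
  triangle.\<close>

type_synonym mesh_index = "dof_index + plane set \<times> tensor_field"

text \<open>Frames and weight bases are attached to edges, not to triangles, so neighbours measure a
  common edge by the same moments. Only \<open>B\<close> varies with the triangle.\<close>

locale mesh_dofs =
  fixes k :: nat and F :: "plane set set" and \<tau> \<nu> :: "plane set \<Rightarrow> plane"
    and S :: "mat2 set" and Q :: "plane set \<Rightarrow> (plane \<Rightarrow> real) set"
    and B :: "plane set \<Rightarrow> tensor_field set"
  assumes finite_F: "finite F"
    and local_dofs: "\<And>f. f \<in> F \<Longrightarrow> local_dofs k f \<tau> \<nu> S Q (B f)"
begin

text \<open>The indices seen by a triangle. The empty bubble set keeps \<open>Interior\<close> out
  of the \<open>Inl\<close> part, so that \<open>local_index\<close> is injective on them.\<close>

fun active :: "plane set \<Rightarrow> mesh_index \<Rightarrow> bool" where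
  "active f (Inl i) \<longleftrightarrow> i \<in> dof_indices f S Q {}"
| "active f (Inr (g, b)) \<longleftrightarrow> g = f \<and> b \<in> B f"

fun local_index :: "mesh_index \<Rightarrow> dof_index" where
  "local_index (Inl i) = i"
| "local_index (Inr (g, b)) = Interior b"

abbreviation "I f \<equiv> dof_indices f S Q (B f)"

definition "J = {j. \<exists>f\<in>F. active f j}"

lemma local_index_mem: "active f j \<Longrightarrow> local_index j \<in> I f"
  by (induction j rule: local_index.induct) (auto simp: dof_indices_def)

lemma local_index_inj: "active f i \<Longrightarrow> active f j \<Longrightarrow> local_index i = local_index j \<Longrightarrow> i = j"
  by (induction i rule: local_index.induct; induction j rule: local_index.induct)
    (auto simp: dof_indices_def)

lemma local_index_surj: "i \<in> I f \<Longrightarrow> \<exists>j. active f j \<and> local_index j = i"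
proof (cases i)
  case (Interior b)
  then show "i \<in> I f \<Longrightarrow> ?thesis"
    by (intro exI[of _ "Inr (f, b)"]) (auto simp: dof_indices_def)
qed (rule exI[of _ "Inl i"]; auto simp: dof_indices_def)+

text \<open>An arbitrary triangle on which a global form is read off; on \<open>fe_space\<close> the
  choice is immaterial by \<open>dof_single_valued\<close>.\<close>

definition "rep j = (SOME f. f \<in> F \<and> active f j)"

lemma rep: "j \<in> J \<Longrightarrow> rep j \<in> F \<and> active (rep j) j"
  unfolding rep_def by (rule someI_ex) (auto simp: J_def)

definition "mesh_dof j \<sigma> = dof (rep j) \<tau> \<nu> (local_index j) (\<sigma> (rep j))"

lemma dof_single_valued:
  assumes "\<sigma> \<in> fe_space k F" "f \<in> F" "g \<in> F" "active f j" "active g j"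
  shows "dof f \<tau> \<nu> (local_index j) (\<sigma> f) = dof g \<tau> \<nu> (local_index j) (\<sigma> g)"
proof -
  interpret f: local_dofs k f \<tau> \<nu> S Q "B f" using local_dofs[OF assms(2)] .
  show ?thesis
  proof (cases j)
    case (Inl i)
    have "edge_moment e (\<tau> e) p (\<sigma> f) = edge_moment e (\<tau> e) p (\<sigma> g) \<and>
        edge_moment e (\<nu> e) p (\<sigma> f) = edge_moment e (\<nu> e) p (\<sigma> g)"
      if "e \<in> edges_of f" "e \<in> edges_of g" "p \<in> Q e" for e p
      using assms(1-3) that f.basis_Q(3)[OF that(1)] f.tangent[OF that(1)] f.normal[OF that(1)]
      unfolding fe_space_def by blast
    moreover have "\<sigma> f x = \<sigma> g x" if "x \<in> verts_of f" "x \<in> verts_of g" for x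
      using assms(1-3) that unfolding fe_space_def by blast
    ultimately show ?thesis
      using assms(4,5) Inl by (auto simp: dof_indices_def)
  next
    case (Inr r)
    then show ?thesis using assms(4,5) by (cases r) auto
  qed
qed

lemma mesh_dof_linear:
  assumes "j \<in> J"
  shows "linear_form_on (fe_space k F) (mesh_dof j)"
proof -
  interpret f: local_dofs k "rep j" \<tau> \<nu> S Q "B (rep j)"
    by (rule local_dofs[OF conjunct1[OF rep[OF assms]]])
  have "linear_form_on (sym_poly_space k (rep j)) (dof (rep j) \<tau> \<nu> (local_index j))"
    using f.dof_linear local_index_mem rep[OF assms] by blast
  moreover have "\<sigma> (rep j) \<in> sym_poly_space k (rep j)" if "\<sigma> \<in> fe_space k F" for \<sigma>
    using that rep[OF assms] by (simp add: fe_space_def)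
  ultimately show ?thesis by (simp add: linear_form_on_def mesh_dof_def)
qed

lemma mesh_dof_kernel:
  assumes \<sigma>: "\<sigma> \<in> fe_space k F" and z: "\<And>j. j \<in> J \<Longrightarrow> mesh_dof j \<sigma> = 0"
  shows "\<sigma> = 0"
proof
  fix f
  show "\<sigma> f = 0 f"
  proof (cases "f \<in> F")
    case True
    interpret f: local_dofs k f \<tau> \<nu> S Q "B f" using local_dofs[OF True] .
    have "dof f \<tau> \<nu> i (\<sigma> f) = 0" if "i \<in> I f" for i
    proof -
      obtain j where j: "active f j" "local_index j = i" using local_index_surj[OF \<open>i \<in> I f\<close>] by blast
      then have "j \<in> J" using True by (auto simp: J_def)
      then show ?thesis
        using dof_single_valued[OF \<sigma> True conjunct1[OF rep] j(1) conjunct2[OF rep]] z[of j] j(2)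
        by (simp add: mesh_dof_def)
    qed
    moreover have "\<sigma> f \<in> sym_poly_space k f" using \<sigma> True by (simp add: fe_space_def)
    ultimately show ?thesis using f.dof_kernel by simp
  next
    case False
    then show ?thesis using \<sigma> by (simp add: fe_space_def)
  qed
qed

text \<open>Local nodal fields with the same global index glue: on every triangle the local forms
  take the values of one global Kronecker symbol, so shared forms agree.\<close>

lemma mesh_nodal_fields_exist:
  "\<exists>W. \<forall>j\<in>J. W j \<in> fe_space k F \<and> (\<forall>i\<in>J. mesh_dof i (W j) = of_bool (j = i))"
proof -
  have "\<exists>w. \<forall>i\<in>I f. w i \<in> sym_poly_space k f \<and> (\<forall>j\<in>I f. dof f \<tau> \<nu> j (w i) = of_bool (i = j))"
    if "f \<in> F" for f
    using local_dofs.nodal_fields_exist[OF local_dofs[OF that]] .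
  then obtain w where w: "\<And>f i. f \<in> F \<Longrightarrow> i \<in> I f \<Longrightarrow> w f i \<in> sym_poly_space k f"
    "\<And>f i j. f \<in> F \<Longrightarrow> i \<in> I f \<Longrightarrow> j \<in> I f \<Longrightarrow> dof f \<tau> \<nu> j (w f i) = of_bool (i = j)"
    by metis
  \<comment> \<open>Zero on triangles that do not see \<open>j\<close>; there all active forms
    vanish, again as the Kronecker symbol requires.\<close>
  define W where "W j = (\<lambda>f. if f \<in> F \<and> active f j then w f (local_index j) else 0)" for j
  have WV: "W j f \<in> sym_poly_space k f" for j f
    using w(1) local_index_mem by (auto simp: W_def intro: subspace_0)
  have nodal: "dof f \<tau> \<nu> (local_index i) (W j f) = of_bool (j = i)" if f: "f \<in> F" and i: "active f i" for f i j
  proof (cases "active f j")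
    case True
    then have "dof f \<tau> \<nu> (local_index i) (W j f) = of_bool (local_index j = local_index i)"
      using w(2)[OF f local_index_mem[OF True] local_index_mem[OF i]] f by (simp add: W_def)
    then show ?thesis using local_index_inj[OF True i] by auto
  next
    case False
    have "dof f \<tau> \<nu> (local_index i) 0 = 0"
      using linear_form_on_sum[OF subspace_sym_poly_space
          local_dofs.dof_linear[OF local_dofs[OF f] local_index_mem[OF i]], of "{}"] by simp
    then show ?thesis using False i by (auto simp: W_def)
  qed
  have "W j \<in> fe_space k F" for j
    unfolding fe_space_def
  proof (intro CollectI conjI ballI allI impI)
    show "W j f \<in> sym_poly_space k f" for f by (rule WV)
    show "W j f = 0" if "f \<notin> F" for f using that by (simp add: W_def)
  next
    fix f g x assume f: "f \<in> F" and g: "g \<in> F" and x: "x \<in> verts_of f \<inter> verts_of g"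
    show "W j f x = W j g x"
    proof (rule local_dofs.vertex_value_eq[OF local_dofs[OF f]])
      show "W j f x \<in> sym_mats" "W j g x \<in> sym_mats" using WV sym_poly_space_sym by blast+
      fix M assume "M \<in> S"
      then show "frob (W j f x) M = frob (W j g x) M"
        using x nodal[OF f, of "Inl (At_vertex x M)" j] nodal[OF g, of "Inl (At_vertex x M)" j]
        by (simp add: dof_indices_def)
    qed
  next
    fix f g e t n p
    assume f: "f \<in> F" and g: "g \<in> F" and e: "e \<in> edges_of f \<inter> edges_of g"
      and tn: "unit_tangent e t \<and> unit_normal e n" and p: "p \<in> poly_space (int k - 2) e"
    interpret f: local_dofs k f \<tau> \<nu> S Q "B f" using local_dofs[OF f] .
    have ef: "e \<in> edges_of f" and eg: "e \<subseteq> g" using e edge_subset by auto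
    obtain a b where ab: "e = closed_segment a b" "a \<noteq> b" using f.at_edge[OF ef] by metis
    \<comment> \<open>Nodality gives agreement for the basis weights and the chosen frame only;
      linearity covers the remaining weights, and sign invariance the remaining unit
      vectors.\<close>
    have *: "edge_moment e u p (W j f) = edge_moment e u p (W j g)" if u: "u = \<tau> e \<or> u = \<nu> e" for u
    proof (rule f.edge_moments_eq[OF ef eg WV WV _ p])
      fix q assume "q \<in> Q e"
      then show "edge_moment e u q (W j f) = edge_moment e u q (W j g)"
        using e u nodal[OF f, of "Inl (Tangential e q)" j] nodal[OF g, of "Inl (Tangential e q)" j]
          nodal[OF f, of "Inl (Normal e q)" j] nodal[OF g, of "Inl (Normal e q)" j]
        by (auto simp: dof_indices_def)
    qed
    have "t = \<tau> e \<or> t = - \<tau> e" using unit_tangent_unique ab tn f.tangent[OF ef] by metis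
    then show "edge_moment e t p (W j f) = edge_moment e t p (W j g)"
      using *[of "\<tau> e"] by (auto simp: edge_moment_neg)
    have "n = \<nu> e \<or> n = - \<nu> e" using unit_normal_unique ab tn f.normal[OF ef] by metis
    then show "edge_moment e n p (W j f) = edge_moment e n p (W j g)"
      using *[of "\<nu> e"] by (auto simp: edge_moment_neg)
  qed
  then show ?thesis
    using nodal rep by (intro exI[of _ W]) (simp add: mesh_dof_def)
qed

lemma J_eq: "J = Inl ` dof_index_set (mesh_verts F) (mesh_edges F) S Q {} \<union> Inr ` (SIGMA f:F. B f)"
proof (rule set_eqI)
  fix j show "j \<in> J \<longleftrightarrow> j \<in> Inl ` dof_index_set (mesh_verts F) (mesh_edges F) S Q {} \<union> Inr ` (SIGMA f:F. B f)"
  proof (cases j)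
    case (Inl i)
    then show ?thesis
      by (auto simp: J_def dof_index_set_def dof_indices_def mesh_verts_def mesh_edges_def image_iff; blast)
  next
    case (Inr r)
    then show ?thesis by (cases r) (auto simp: J_def)
  qed
qed

lemma finite_mesh: "finite (mesh_verts F)" "finite (mesh_edges F)"
proof -
  have "framed_triangle k f \<tau> \<nu>" if "f \<in> F" for f
    using local_dofs[OF that] by (simp add: local_dofs_def)
  then show "finite (mesh_verts F)" "finite (mesh_edges F)"
    unfolding mesh_verts_def mesh_edges_def using finite_F framed_triangle.triangle_facts(4,6) by blast+
qed

lemma mesh_Q:
  assumes "e \<in> mesh_edges F"
  shows "finite (Q e)" "card (Q e) = k - 1"
proof -
  obtain f where "f \<in> F" "e \<in> edges_of f" using assms by (auto simp: mesh_edges_def)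
  then show "finite (Q e)" "card (Q e) = k - 1"
    using local_dofs.basis_Q(1,2)[OF local_dofs] by blast+
qed

lemma finite_J: "finite J"
\<comment> \<open>Finiteness of \<open>S\<close> is known only through some triangle, hence the
  separate empty case.\<close>
proof (cases "F = {}")
  case True
  show ?thesis unfolding J_def by (simp add: True)
next
  case False
  then have "finite S" using local_dofs local_dofs.basis_sets(1) by blast
  then show ?thesis
    unfolding J_eq using finite_F finite_mesh mesh_Q(1) local_dofs.basis_B(1)[OF local_dofs] \<open>finite S\<close>
    by (intro finite_UnI finite_imageI finite_dof_index_set finite_SigmaI) auto
qed

lemma dim_fe_space: "dim (fe_space k F) = card J"
proof -
  obtain W where W: "\<And>j. j \<in> J \<Longrightarrow> W j \<in> fe_space k F"
    "\<And>i j. i \<in> J \<Longrightarrow> j \<in> J \<Longrightarrow> mesh_dof j (W i) = of_bool (i = j)"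
    using mesh_nodal_fields_exist by blast
  have sub: "subspace (fe_space k F)"
    by (rule subspace_fe_space) (use local_dofs in \<open>auto simp: local_dofs_def framed_triangle_def\<close>)
  show ?thesis
    by (rule dim_eq_card_forms[where L = mesh_dof and w = W, OF sub finite_J]; (fact mesh_dof_linear mesh_dof_kernel W)?)
qed

text \<open>Each vertex and edge is counted once for the whole mesh, each bubble basis once per
  triangle; doubling keeps the count in the naturals.\<close>

lemma card_J:
  "2 * card J = 6 * card (mesh_verts F) + 4 * (k - 1) * card (mesh_edges F) + 3 * (k - 1) * k * card F"
proof (cases "F = {}")
  case True
  show ?thesis unfolding J_def by (simp add: True mesh_verts_def mesh_edges_def)
next
  case False
  then have S: "finite S" "card S = 3"
    using local_dofs local_dofs.basis_sets(1,2) by blast+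
  let ?I = "dof_index_set (mesh_verts F) (mesh_edges F) S Q {}"
  have fin: "finite ?I" "finite (SIGMA f:F. B f)"
    using finite_F finite_mesh mesh_Q(1) S local_dofs.basis_B(1)[OF local_dofs]
    by (auto intro!: finite_dof_index_set)
  have "card J = card (Inl ` ?I :: mesh_index set) + card (Inr ` (SIGMA f:F. B f) :: mesh_index set)"
    unfolding J_eq by (rule card_Un_disjoint) (use fin in auto)
  also have "\<dots> = card ?I + card (SIGMA f:F. B f)"
    by (simp add: card_image)
  also have "card ?I = (\<Sum>i\<in>?I. 1)" by simp
  also have "\<dots> = 3 * card (mesh_verts F) + 2 * ((k - 1) * card (mesh_edges F))"
    by (subst sum_dof_index_set) (use finite_mesh mesh_Q S in auto)
  also have "card (SIGMA f:F. B f) = (\<Sum>f\<in>F. card (B f))"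
    using finite_F local_dofs.basis_B(1)[OF local_dofs] by (intro card_SigmaI) auto
  finally have "2 * card J = 6 * card (mesh_verts F) + 4 * ((k - 1) * card (mesh_edges F)) + (\<Sum>f\<in>F. 2 * card (B f))"
    by (simp add: sum_distrib_left)
  also have "(\<Sum>f\<in>F. 2 * card (B f)) = (\<Sum>f\<in>F. 3 * (k * (k - 1)))"
    using local_dofs.card_B[OF local_dofs] by (intro sum.cong) auto
  finally show ?thesis by (simp add: mult_ac)
qed

end

lemma mesh_dofs_exist:
  assumes k: "k \<ge> 1" and F: "finite F" "\<And>f. f \<in> F \<Longrightarrow> 2 simplex f"
  shows "\<exists>\<tau> \<nu> S Q B. mesh_dofs k F \<tau> \<nu> S Q B"
proof -
  obtain S where S: "is_basis_of S sym_mats" using basis_of_subspace[OF subspace_sym_mats] ..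
  obtain Q where Q: "\<And>e. is_basis_of (Q e) (poly_space (int k - 2) e)"
    using basis_of_subspace[OF subspace_poly_space] by metis
  obtain B where B: "\<And>f. is_basis_of (B f) (bubble_space k f)"
    using basis_of_subspace[OF subspace_bubble_space] by metis
  \<comment> \<open>The choice depends on the edge alone, so all triangles sharing it get the same
    frame.\<close>
  define \<tau> where "\<tau> e = (SOME t. unit_tangent e t)" for e
  define \<nu> where "\<nu> e = (SOME n. unit_normal e n)" for e
  have "unit_tangent e (\<tau> e) \<and> unit_normal e (\<nu> e)" if f: "f \<in> F" and e: "e \<in> edges_of f" for f e
  proof -
    obtain a b c where "is_triangle a b c f" by (rule simplex_imp_triangle[OF F(2)[OF f]])
    from this e obtain x y z where "is_triangle x y z f" "e = closed_segment x y" by (rule triangle_at_edge)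
    then show ?thesis
      unfolding \<tau>_def \<nu>_def using unit_tangent_exists[of x y] unit_normal_exists[of x y] triangle_distinct
      by (auto intro!: someI_ex[of "unit_tangent _"] someI_ex[of "unit_normal _"])
  qed
  then have "local_dofs k f \<tau> \<nu> S Q (B f)" if "f \<in> F" for f
    using that k F S Q B by unfold_locales auto
  then have "mesh_dofs k F \<tau> \<nu> S Q B" using F(1) by (intro mesh_dofs.intro)
  then show ?thesis by blast
qed

theorem proposition3p2:
  fixes k :: nat
  assumes "k \<ge> 1"
  shows "(\<forall>f \<tau> \<nu> S Q B.
            2 simplex f \<and>
            (\<forall>e\<in>edges_of f. unit_tangent e (\<tau> e) \<and> unit_normal e (\<nu> e)) \<and>
            is_basis_of S sym_mats \<and>
            (\<forall>e\<in>edges_of f. is_basis_of (Q e) (poly_space (int k - 2) e)) \<and>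
            is_basis_of B (bubble_space k f)
            \<longrightarrow> unisolvent (sym_poly_space k f) (dof_indices f S Q B) (dof f \<tau> \<nu>)) \<and>
         (\<forall>\<Omega> F.
            polygonal_domain \<Omega> \<and> triangulates F (closure \<Omega>)
            \<longrightarrow> real (dim (fe_space k F)) =
                  3 * real (card (mesh_verts F))
                  + 2 * (real k - 1) * real (card (mesh_edges F))
                  + 3 / 2 * (real k - 1) * real k * real (card F))"
proof (intro conjI allI impI)
  fix f \<tau> \<nu> S Q B
  assume "2 simplex f \<and>
            (\<forall>e\<in>edges_of f. unit_tangent e (\<tau> e) \<and> unit_normal e (\<nu> e)) \<and>
            is_basis_of S sym_mats \<and>
            (\<forall>e\<in>edges_of f. is_basis_of (Q e) (poly_space (int k - 2) e)) \<and>
            is_basis_of B (bubble_space k f)"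
  then interpret local_dofs k f \<tau> \<nu> S Q B
    using assms by (intro local_dofs.intro framed_triangle.intro local_dofs_axioms.intro) blast+
  show "unisolvent (sym_poly_space k f) (dof_indices f S Q B) (dof f \<tau> \<nu>)"
    by (rule unisolvent_dofs)
next
  fix \<Omega> F assume "polygonal_domain \<Omega> \<and> triangulates F (closure \<Omega>)"
  then have F: "finite F" "\<And>f. f \<in> F \<Longrightarrow> 2 simplex f"
    by (auto simp: triangulates_def triangulation_def)
  obtain \<tau> \<nu> S Q B where "mesh_dofs k F \<tau> \<nu> S Q B" using mesh_dofs_exist[OF assms F] by blast
  then interpret mesh_dofs k F \<tau> \<nu> S Q B .
  have "2 * dim (fe_space k F) = 6 * card (mesh_verts F) + 4 * (k - 1) * card (mesh_edges F) + 3 * (k - 1) * k * card F"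
    using dim_fe_space card_J by simp
  then have "real (2 * dim (fe_space k F)) = real (6 * card (mesh_verts F) + 4 * (k - 1) * card (mesh_edges F) + 3 * (k - 1) * k * card F)"
    by (rule arg_cong)
  then show "real (dim (fe_space k F)) = 3 * real (card (mesh_verts F))
      + 2 * (real k - 1) * real (card (mesh_edges F)) + 3 / 2 * (real k - 1) * real k * real (card F)"
    \<comment> \<open>\<open>k \<ge> 1\<close> makes the truncated subtraction \<open>k - 1\<close>
      a genuine one over the reals.\<close>
    using assms by (simp add: of_nat_diff field_simps)
qed

end
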